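(* Let $M,N\ge1$, $\boldsymbol{u}=(u_1,\dots,u_N)$, and let the rational functions $R_i(p,\boldsymbol{u})=\sum_{j=1}^N\frac{r_{ij}(\boldsymbol{u})}{p-p_j(\boldsymbol{u})}$, $1\le i\le N$, the function $z(p,\boldsymbol{u})$ with inverse $p(z,\boldsymbol{u})$, the points $z_{0,i}$, the functions $z_\alpha(p,\boldsymbol{u})$ and $q_i(\boldsymbol{u})$, and the functions $\Omega_A(p,\boldsymbol{u})$, $A\in\boldsymbol{A}$, be as in the context. Put $$\mathcal{S}(p,\boldsymbol{u},\boldsymbol{t})=\mathcal{S}_+(p,\boldsymbol{u},\boldsymbol{t})+\mathcal{S}_-(p,\boldsymbol{u}),\qquad \mathcal{S}_+:=\sum_{A\in\boldsymbol{A}}t_A\,\Omega_A(p,\boldsymbol{u}),$$ where $\mathcal{S}_-(p,\boldsymbol{u})$ is an analytic function of $p$ on $\mathcal{D}$ with $\lim_{p\to\infty}\mathcal{S}_-(p,\boldsymbol{u})=0$. Suppose that $\mathcal{S}_-$ satisfies $$\frac{\partial \mathcal{S}_-}{\partial u_i}+R_i\frac{\partial \mathcal{S}_-}{\partial p}=\sum_{k=1}^N\frac{r_{ik}F_k}{p-p_k},\quad 1\le i\le N,$$ for a given set of functions $\{F_i=F_i(\boldsymbol{u})\}_{i=1}^N$ verifying the compatibility conditions $$r_{ik}\frac{\partial F_k}{\partial u_j}-r_{jk}\frac{\partial F_k}{\partial u_i}=\sum_{l\ne k}\frac{r_{jl}r_{ik}-r_{il}r_{jk}}{(p_k-p_l)^2}(F_k-F_l),\quad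 i\ne j,\ 1\le k\le N,$$ and suppose that the functions $\{u_i=u_i(\boldsymbol{t})\}_{i=1}^N$ are implicitly determined by the hodograph relations $$\sum_{A\in\boldsymbol{A}}t_A\frac{\partial\Omega_A}{\partial p}(p_i(\boldsymbol{u}),\boldsymbol{u})+F_i(\boldsymbol{u})=0,\quad 1\le i\le N.$$ Then the function $$S(z,\boldsymbol{t}):=\mathcal{S}\big(p(z,\boldsymbol{u}(\boldsymbol{t})),\boldsymbol{u}(\boldsymbol{t}),\boldsymbol{t}\big)$$ is an $S$-function for the Whitham hierarchy, that is, $$\frac{\partial S(z,\boldsymbol{t})}{\partial t_A}=\Omega_A\big(p(z,\boldsymbol{u}(\boldsymbol{t})),\boldsymbol{u}(\boldsymbol{t})\big)\quad\text{for all }A\in\boldsymbol{A}.$$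
   Context: Index set: $\boldsymbol{A}=\{(\alpha,0): 2\le\alpha\le M\}\cup\{(\alpha,n): 1\le\alpha\le M,\ n\ge 1\}$; $\boldsymbol{t}=\{t_A:A\in\boldsymbol{A}\}$ are complex time parameters. Sums over $\boldsymbol{A}$ are understood as well defined and termwise differentiable (e.g. only finitely many $t_A$ in the sum are nonzero). All functions are assumed to depend smoothly (analytically) on $\boldsymbol{u}$ and $\boldsymbol{t}$ wherever they are differentiated. The functions $R_i$: they are rational in $p$, vanish at $p=\infty$, and have singularities only at $N$ simple poles $p_1(\boldsymbol{u}),\dots,p_N(\boldsymbol{u})$, so $R_i(p,\boldsymbol{u})=\sum_{j=1}^N\frac{r_{ij}(\boldsymbol{u})}{p-p_j(\boldsymbol{u})}$. The coefficients satisfy, for $i\ne j$ and all $k$, $$r_{ik}\frac{\partial p_k}{\partial u_j}-r_{jk}\frac{\partial p_k}{\partial u_i}=\sum_{l\ne k}\frac{r_{jl}r_{ik}-r_{il}r_{jk}}{p_k-p_l},\qquad \frac{\partial r_{ik}}{\partial u_j}-\frac{\partial r_{jk}}{\partial u_i}=2\sum_{l\ne k}\frac{r_{jk}r_{il}-r_{ik}r_{jl}}{(p_k-p_l)^2}.$$ The function $z$: $z=z(p,\boldsymbol{u})$ is a solution of $$\frac{\partial z}{\partial u_i}+R_i(p,\boldsymbol{u})\frac{\partial z}{\partial p}=0,\quad 1\le i\le N,$$ equivalently its inverse function $p=p(z,\boldsymbol{u})$ satisfies $\frac{\partial p}{\partial u_i}=R_i(p,\boldsymbol{u})$; it has the Laurent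 expansion $z(p,\boldsymbol{u})=p+\sum_{n\ge1}a_n(\boldsymbol{u})p^{-n}$ as $p\to\infty$, and it defines a univalent analytic function $z:\mathcal{D}\to\mathcal{D}'$ between two neighborhoods $\mathcal{D}$ and $\mathcal{D}'$ of $\infty$ in the extended complex planes of $p$ and $z$ respectively. The functions $z_\alpha$: take $M-1$ different finite points $z_{0,i}\in\mathcal{D}'$, $2\le i\le M$, and set $z_1(p,\boldsymbol{u}):=z(p,\boldsymbol{u})$, $z_i(p,\boldsymbol{u}):=\dfrac{1}{z(p,\boldsymbol{u})-z_{0,i}}$ for $2\le i\le M$. Then $z_i$ has a simple pole at $q_i(\boldsymbol{u}):=p(z_{0,i},\boldsymbol{u})$, with an expansion $z_i=\frac{a_{i,-1}(\boldsymbol{u})}{p-q_i(\boldsymbol{u})}+\sum_{n\ge0}a_{i,n}(\boldsymbol{u})(p-q_i(\boldsymbol{u}))^n$ as $p\to q_i(\boldsymbol{u})$. The points $p_k(\boldsymbol{u})$ are taken distinct from the points $q_i(\boldsymbol{u})$, so that the hodograph relations make sense. The functions $\Omega_A$: $\Omega_{(i,0)}(p,\boldsymbol{u})=-\ln(p-q_i(\boldsymbol{u}))$ for $2\le i\le M$, and $\Omega_{(\alpha,n)}(p,\boldsymbol{u})=\big((z_\alpha)^n\big)_+$ for $1\le\alpha\le M$, $n\ge1$, where for $\alpha=1$, $(\cdot)_+$ takes the polynomial part (powers $p^n$, $n\ge0$) of the Laurent series at $p=\infty$, and for $\alpha=i\ge2$, $(\cdot)_+$ takes the strictly singular part (powers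 $(p-q_i)^{-n}$, $n\ge1$) of the Laurent series at $p=q_i(\boldsymbol{u})$. An $S$-function for the Whitham hierarchy is a function $S(z,\boldsymbol{t})$ with $\partial S(z,\boldsymbol{t})/\partial t_A=\Omega_A(p(z,\boldsymbol{t}),\boldsymbol{t})$ for all $A\in\boldsymbol{A}$; here $p(z,\boldsymbol{t}):=p(z,\boldsymbol{u}(\boldsymbol{t}))$ and $\Omega_A(p,\boldsymbol{t}):=\Omega_A(p,\boldsymbol{u}(\boldsymbol{t}))$. *)

theory Defs
  imports "HOL-Complex_Analysis.Complex_Analysis"
begin

unbundle no fps_syntax

text \<open>
  Analyticity in several complex variables is rendered as complex-linear Frechet differentiability
  at every point of an open set.
\<close>

definition vec_holomorphic_on :: "(complex^'n \<Rightarrow> complex) \<Rightarrow> (complex^'n) set \<Rightarrow> bool" where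
  "vec_holomorphic_on f U \<longleftrightarrow>
     (\<forall>v\<in>U. \<exists>d. (f has_derivative (\<lambda>h. \<Sum>i\<in>UNIV. d i * h $ i)) (at v))"

definition joint_holomorphic_on ::
    "(complex \<Rightarrow> complex^'n \<Rightarrow> complex) \<Rightarrow> (complex \<times> (complex^'n)) set \<Rightarrow> bool" where
  "joint_holomorphic_on f G \<longleftrightarrow>
     (\<forall>(p, v)\<in>G. \<exists>c d. ((\<lambda>(x, w). f x w) has_derivative
        (\<lambda>(k, h). c * k + (\<Sum>i\<in>UNIV. d i * h $ i))) (at (p, v)))"

definition partial :: "'n \<Rightarrow> (complex^'n \<Rightarrow> complex) \<Rightarrow> complex^'n \<Rightarrow> complex" where
  "partial i f v = deriv (\<lambda>w. f (\<chi> j. if j = i then w else v $ j)) (v $ i)"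

text \<open>
  Neighbourhoods of infinity in the extended plane depending on a parameter \<open>v \<in> U\<close>, represented
  by their finite parts: the total space is open, also along the section at infinity.
\<close>

definition total_space :: "'v set \<Rightarrow> ('v \<Rightarrow> complex set) \<Rightarrow> (complex \<times> 'v) set" where
  "total_space U D = {(p, v). v \<in> U \<and> p \<in> D v}"

definition infinity_nbhds :: "(complex^'n) set \<Rightarrow> (complex^'n \<Rightarrow> complex set) \<Rightarrow> bool" where
  "infinity_nbhds U D \<longleftrightarrow> open (total_space U D) \<and>
     (\<forall>v\<in>U. \<exists>R. eventually (\<lambda>w. \<forall>p. norm p > R \<longrightarrow> p \<in> D w) (nhds v))"

definition Rfun ::
    "('n \<Rightarrow> 'n \<Rightarrow> complex^'n \<Rightarrow> complex) \<Rightarrow> ('n \<Rightarrow> complex^'n \<Rightarrow> complex) \<Rightarrow>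
     'n \<Rightarrow> complex \<Rightarrow> complex^'n \<Rightarrow> complex" where
  "Rfun r pole i p v = (\<Sum>j\<in>UNIV. r i j v / (p - pole j v))"

definition inverse_fun ::
    "('v \<Rightarrow> complex set) \<Rightarrow> (complex \<Rightarrow> 'v \<Rightarrow> complex) \<Rightarrow> complex \<Rightarrow> 'v \<Rightarrow> complex" where
  "inverse_fun D z x v = the_inv_into (D v) (\<lambda>p. z p v) x"

definition zfun ::
    "(nat \<Rightarrow> complex) \<Rightarrow> (complex \<Rightarrow> 'v \<Rightarrow> complex) \<Rightarrow> nat \<Rightarrow> complex \<Rightarrow> 'v \<Rightarrow> complex" where
  "zfun z0 z \<alpha> p v = (if \<alpha> = 1 then z p v else 1 / (z p v - z0 \<alpha>))"

text \<open>
  The polynomial \<open>fls_prpart L\<close> collects the coefficients of the negative powers of the formal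
  Laurent series \<open>L\<close>, with powers negated and constant term 0. At infinity the local parameter
  is \<open>1/p\<close>, and the constant term is retained.
\<close>

definition polynomial_part :: "(complex \<Rightarrow> complex) \<Rightarrow> complex \<Rightarrow> complex" where
  "polynomial_part f p =
     (let L = laurent_expansion (\<lambda>w. f (1 / w)) 0
      in poly (fls_prpart L) p + fls_nth L 0)"

definition singular_part :: "(complex \<Rightarrow> complex) \<Rightarrow> complex \<Rightarrow> complex \<Rightarrow> complex" where
  "singular_part f q p = poly (fls_prpart (laurent_expansion f q)) (1 / (p - q))"

definition index_set :: "nat \<Rightarrow> (nat \<times> nat) set" where
  "index_set M = {(\<alpha>, 0) | \<alpha>. 2 \<le> \<alpha> \<and> \<alpha> \<le> M} \<union> {(\<alpha>, n) | \<alpha> n. 1 \<le> \<alpha> \<and> \<alpha> \<le> M \<and> 1 \<le> n}"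

text \<open>The argument \<open>lnq \<alpha>\<close> is a chosen branch of the multivalued \<open>ln (p - q \<alpha> v)\<close>.\<close>

definition Omega ::
    "(nat \<Rightarrow> complex \<Rightarrow> 'v \<Rightarrow> complex) \<Rightarrow> (nat \<Rightarrow> complex) \<Rightarrow> (complex \<Rightarrow> 'v \<Rightarrow> complex) \<Rightarrow>
     (nat \<Rightarrow> 'v \<Rightarrow> complex) \<Rightarrow> nat \<times> nat \<Rightarrow> complex \<Rightarrow> 'v \<Rightarrow> complex" where
  "Omega lnq z0 z q A p v =
     (case A of (\<alpha>, n) \<Rightarrow>
        if n = 0 then - lnq \<alpha> p v
        else if \<alpha> = 1 then polynomial_part (\<lambda>x. zfun z0 z \<alpha> x v ^ n) p
        else singular_part (\<lambda>x. zfun z0 z \<alpha> x v ^ n) (q \<alpha> v) p)"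

definition time_sum ::
    "'a set \<Rightarrow> ('a \<Rightarrow> complex \<Rightarrow> 'v \<Rightarrow> complex) \<Rightarrow> complex \<Rightarrow> 'v \<Rightarrow> ('a \<Rightarrow> complex) \<Rightarrow> complex" where
  "time_sum I Om p v t = (\<Sum>\<^sub>\<infinity>A\<in>I. t A * Om A p v)"

definition termwise_differentiable ::
    "'a set \<Rightarrow> ('a \<Rightarrow> complex \<Rightarrow> complex^'n \<Rightarrow> complex) \<Rightarrow> (complex \<times> (complex^'n)) set \<Rightarrow>
     ('a \<Rightarrow> complex) \<Rightarrow> bool" where
  "termwise_differentiable I Om W t \<longleftrightarrow>
     joint_holomorphic_on (\<lambda>p v. time_sum I Om p v t) W \<and>
     (\<forall>(p, v)\<in>W.
        (\<lambda>A. t A * Om A p v) summable_on I \<and>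
        ((\<lambda>A. t A * deriv (\<lambda>x. Om A x v) p) has_sum deriv (\<lambda>x. time_sum I Om x v t) p) I \<and>
        (\<forall>i. ((\<lambda>A. t A * partial i (Om A p) v) has_sum
                partial i (\<lambda>w. time_sum I Om p w t) v) I))"

text \<open>
  \<open>S\<close> is an S-function, for the dependence \<open>u\<close> of the parameters on the times, at all \<open>(x, t)\<close>
  in \<open>X\<close>; here \<open>x\<close> stands for the values of \<open>z\<close>.
\<close>

definition whitham_S_function ::
    "'a set \<Rightarrow> ('a \<Rightarrow> complex \<Rightarrow> 'v \<Rightarrow> complex) \<Rightarrow> (complex \<Rightarrow> 'v \<Rightarrow> complex) \<Rightarrow>
     (('a \<Rightarrow> complex) \<Rightarrow> 'v) \<Rightarrow> (complex \<times> ('a \<Rightarrow> complex)) set \<Rightarrow>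
     (complex \<Rightarrow> ('a \<Rightarrow> complex) \<Rightarrow> complex) \<Rightarrow> bool" where
  "whitham_S_function I Om P u X S \<longleftrightarrow>
     (\<forall>(x, t)\<in>X. \<forall>A\<in>I.
        ((\<lambda>s. S x (t(A := s))) has_field_derivative Om A (P x (u t)) (u t)) (at (t A)))"

end

theory Submission
  imports Defs
begin

text \<open>
  Along the level sets of \<open>z\<close>, \<open>p\<close> satisfies \<open>\<partial>p/\<partial>u\<^sub>i = R\<^sub>i\<close>, so it suffices that
  \<open>\<partial>\<^sub>i + R\<^sub>i \<partial>\<^sub>p\<close> annihilates the total function \<open>S\<^sub>+ + S\<^sub>-\<close> on the hodograph locus. This reduces to
  \<open>\<partial>\<^sub>i \<Omega>\<^sub>A + R\<^sub>i \<partial>\<^sub>p \<Omega>\<^sub>A = \<Sum>\<^sub>k r\<^sub>i\<^sub>k / (p - p\<^sub>k) * \<partial>\<^sub>p \<Omega>\<^sub>A (p\<^sub>k)\<close>: summing over \<open>A\<close>, the hodograph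
  relations turn the right-hand side into minus the source term of the equation for \<open>S\<^sub>-\<close>. For \<open>n \<ge> 1\<close>
  the polynomial and singular parts are Cauchy integrals of powers of \<open>z\<^sub>\<alpha>\<close> over a circle that can
  be kept fixed while \<open>u\<close> varies; differentiating under the integral, inserting the equation for
  \<open>z\<close> and decomposing \<open>R\<^sub>i(\<zeta>) / (\<zeta> - p)\<close> into partial fractions gives the identity.
\<close>

text \<open>The transport identity evaluates \<Omega>_A at the poles p_k, where z need not be
  defined. The Cauchy integral resolves this: it samples z only on the circle, yet represents the
  polynomial part at every point inside and the singular part at every point outside, so the circle
  is chosen with p and all p_k on the right side of it. A pole may also lie in D, even at p itself,
  where the partial fractions would divide by zero; univalence of z forces the residue r_ik to
  vanish at such a pole, and the formulas survive. For the indices (\<alpha>, 0) the identity comes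
  instead from \<partial>q/\<partial>u_i = R_i(q), because the puncture q is itself a value of the
  inverse function. In the t_A-derivative the explicit dependence is split off exactly: the sum for
  \<open>t(A := s)\<close> is the sum for t plus (s - t_A) \<Omega>_A. The first sum together with
  S_- is stationary along the moving point, and the second term has derivative \<Omega>_A by
  continuity alone.\<close>

section \<open>Coordinate slices and joint holomorphy\<close>

definition upd :: "'n \<Rightarrow> complex^'n \<Rightarrow> complex \<Rightarrow> complex^'n" where
  "upd i v w = (\<chi> j. if j = i then w else v $ j)"

lemma upd_eq_axis: "upd i v w = v + axis i (w - v $ i)"
  by (simp add: upd_def axis_def vec_eq_iff)

lemma upd_same [simp]: "upd i v (v $ i) = v"
  by (simp add: upd_def vec_eq_iff)

lemma upd_upd [simp]: "upd i (upd i v w') w = upd i v w"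
  by (simp add: upd_def vec_eq_iff)

lemma upd_nth [simp]: "upd i v w $ i = w"
  by (simp add: upd_def)

lemma partial_eq_deriv_upd: "partial i f v = deriv (\<lambda>w. f (upd i v w)) (v $ i)"
  by (simp add: partial_def upd_def)

lemma norm_axis: "norm (axis i (x :: complex)) = norm x"
proof -
  have "(\<Sum>j\<in>UNIV. (norm (axis i x $ j))\<^sup>2) = (\<Sum>j\<in>UNIV. if j = i then (norm x)\<^sup>2 else 0)"
    by (intro sum.cong) (auto simp: axis_def)
  thus ?thesis
    by (simp add: norm_vec_def L2_set_def)
qed

lemma bounded_linear_axis: "bounded_linear (axis i :: complex \<Rightarrow> complex^'n)"
  by (rule bounded_linear_intro[where K = 1]) (auto simp: norm_axis, auto simp: axis_def vec_eq_iff)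

lemma upd_has_derivative: "(upd i v has_derivative axis i) (at w)"
proof -
  have "((\<lambda>w. v + axis i (w - v $ i)) has_derivative (\<lambda>k. axis i k)) (at w)"
    by (auto intro!: derivative_eq_intros bounded_linear.has_derivative[OF bounded_linear_axis])
  thus ?thesis
    by (simp add: upd_eq_axis[abs_def])
qed

lemma continuous_upd: "continuous_on A (upd i v)"
  using has_derivative_continuous[OF upd_has_derivative]
  by (auto simp: continuous_on_eq_continuous_within intro: continuous_within_subset)

lemma sum_axis: "(\<Sum>j\<in>UNIV. d j * axis i (x :: complex) $ j) = d i * x"
proof -
  have "(\<Sum>j\<in>UNIV. d j * axis i x $ j) = (\<Sum>j\<in>UNIV. if j = i then d i * x else 0)"
    by (intro sum.cong) (auto simp: axis_def)
  thus ?thesis by simp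
qed

lemma vec_derivative_partial:
  fixes f :: "complex^'n \<Rightarrow> complex"
  assumes "(f has_derivative (\<lambda>h. \<Sum>j\<in>UNIV. d j * h $ j)) (at v)"
  shows "((\<lambda>w. f (upd i v w)) has_field_derivative d i) (at (v $ i))"
proof -
  have "((\<lambda>w. f (upd i v w)) has_derivative (\<lambda>k. \<Sum>j\<in>UNIV. d j * axis i k $ j)) (at (v $ i))"
    by (rule has_derivative_compose[OF upd_has_derivative]) (use assms in simp)
  thus ?thesis
    by (simp add: sum_axis has_field_derivative_def)
qed

lemma joint_derivative_fst:
  fixes f :: "complex \<Rightarrow> complex^'n \<Rightarrow> complex"
  assumes "((\<lambda>(x, w). f x w) has_derivative (\<lambda>(k, h). c * k + (\<Sum>j\<in>UNIV. d j * h $ j))) (at (p, v))"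
  shows "((\<lambda>x. f x v) has_field_derivative c) (at p)"
proof -
  have "((\<lambda>x. (\<lambda>(x, w). f x w) (x, v)) has_derivative
      (\<lambda>k. (\<lambda>(k, h). c * k + (\<Sum>j\<in>UNIV. d j * h $ j)) (k, 0))) (at p)"
    by (rule has_derivative_compose[where f = "\<lambda>x. (x, v)"])
       (use assms in \<open>auto intro!: derivative_eq_intros\<close>)
  thus ?thesis
    by (simp add: has_field_derivative_def)
qed

lemma joint_derivative_snd:
  fixes f :: "complex \<Rightarrow> complex^'n \<Rightarrow> complex"
  assumes "((\<lambda>(x, w). f x w) has_derivative (\<lambda>(k, h). c * k + (\<Sum>j\<in>UNIV. d j * h $ j))) (at (p, v))"
  shows "(f p has_derivative (\<lambda>h. \<Sum>j\<in>UNIV. d j * h $ j)) (at v)"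
proof -
  have "((\<lambda>w. (\<lambda>(x, w). f x w) (p, w)) has_derivative
      (\<lambda>h. (\<lambda>(k, h). c * k + (\<Sum>j\<in>UNIV. d j * h $ j)) (0, h))) (at v)"
    by (rule has_derivative_compose[where f = "\<lambda>w. (p, w)"])
       (use assms in \<open>auto intro!: derivative_eq_intros\<close>)
  thus ?thesis by simp
qed

text \<open>Restriction to the coordinate lines through the point identifies the anonymous
  coefficients in \<open>joint_holomorphic_on\<close>; from here on \<open>deriv\<close> and
  \<open>partial\<close> can serve as the coefficients of the full derivative.\<close>

lemma joint_holomorphic_has_derivative:
  assumes "joint_holomorphic_on f G" "(p, v) \<in> G"
  shows "((\<lambda>(x, w). f x w) has_derivative
     (\<lambda>(k, h). deriv (\<lambda>x. f x v) p * k + (\<Sum>i\<in>UNIV. partial i (f p) v * h $ i))) (at (p, v))"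
proof -
  obtain c d where *: "((\<lambda>(x, w). f x w) has_derivative
      (\<lambda>(k, h). c * k + (\<Sum>j\<in>UNIV. d j * h $ j))) (at (p, v))"
    using assms unfolding joint_holomorphic_on_def by fastforce
  have "deriv (\<lambda>x. f x v) p = c"
    using joint_derivative_fst[OF *] by (rule DERIV_imp_deriv)
  moreover have "partial i (f p) v = d i" for i
    unfolding partial_eq_deriv_upd
    using vec_derivative_partial[OF joint_derivative_snd[OF *]] by (rule DERIV_imp_deriv)
  ultimately show ?thesis using * by simp
qed

lemma joint_holomorphic_deriv:
  assumes "joint_holomorphic_on f G" "(p, v) \<in> G"
  shows "((\<lambda>x. f x v) has_field_derivative deriv (\<lambda>x. f x v) p) (at p)"
  using joint_derivative_fst[OF joint_holomorphic_has_derivative[OF assms]] .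

lemma joint_holomorphic_partial:
  assumes "joint_holomorphic_on f G" "(p, v) \<in> G"
  shows "((\<lambda>w. f p (upd i v w)) has_field_derivative partial i (f p) v) (at (v $ i))"
  using vec_derivative_partial[OF joint_derivative_snd[OF joint_holomorphic_has_derivative[OF assms]]] .

lemma joint_holomorphic_partial_upd:
  assumes "joint_holomorphic_on f G" "(p, upd i v w) \<in> G"
  shows "((\<lambda>w. f p (upd i v w)) has_field_derivative partial i (f p) (upd i v w)) (at w)"
  using joint_holomorphic_partial[OF assms, of i] by simp

lemma joint_holomorphic_continuous:
  assumes "joint_holomorphic_on f G"
  shows "continuous_on G (\<lambda>(p, v). f p v)"
proof (rule continuous_at_imp_continuous_on, safe)
  fix p v assume "(p, v) \<in> G"
  from has_derivative_continuous[OF joint_holomorphic_has_derivative[OF assms this]]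
  show "isCont (\<lambda>(p, v). f p v) (p, v)" .
qed

lemma joint_holomorphic_slice:
  assumes "joint_holomorphic_on f G" "\<And>p. p \<in> S \<Longrightarrow> (p, v) \<in> G"
  shows "(\<lambda>p. f p v) holomorphic_on S"
  unfolding holomorphic_on_def field_differentiable_def
  using joint_holomorphic_deriv[OF assms(1)] assms(2) by (blast intro: has_field_derivative_at_within)

lemma joint_holomorphic_subset:
  "joint_holomorphic_on f G \<Longrightarrow> H \<subseteq> G \<Longrightarrow> joint_holomorphic_on f H"
  unfolding joint_holomorphic_on_def by blast

text \<open>Cauchy's estimate on a disc of radius \<open>\<rho>\<close> in the \<open>i\<close>-th direction, applied to the remainder
  of the first-order expansion at \<open>(p, v)\<close>, which is at most \<open>e\<close> times a multiple of \<open>\<rho>\<close> there.\<close>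

lemma joint_holomorphic_continuous_partial:
  assumes f: "joint_holomorphic_on f G" and "open G"
  shows "continuous_on G (\<lambda>(p, v). partial i (f p) v)"
proof (rule continuous_at_imp_continuous_on, safe)
  fix p v assume pv: "(p, v) \<in> G"
  define c where "c = deriv (\<lambda>x. f x v) p"
  define d where "d = (\<lambda>i. partial i (f p) v)"
  define L where "L = (\<lambda>(k, h :: complex^'a). c * k + (\<Sum>j\<in>UNIV. d j * h $ j))"
  have der: "((\<lambda>(x, w). f x w) has_derivative L) (at (p, v))"
    using joint_holomorphic_has_derivative[OF f pv] by (simp add: L_def c_def d_def)
  show "isCont (\<lambda>(p, v). partial i (f p) v) (p, v)"
    unfolding continuous_at_eps_delta
  proof (intro allI impI)
    fix e :: real assume "e > 0"
    obtain \<delta>1 where \<delta>1: "\<delta>1 > 0" "ball (p, v) \<delta>1 \<subseteq> G"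
      using \<open>open G\<close> pv open_contains_ball by blast
    obtain \<delta>2 where \<delta>2: "\<delta>2 > 0"
      "\<And>y. norm (y - (p, v)) < \<delta>2 \<Longrightarrow>
         norm ((\<lambda>(x, w). f x w) y - f p v - L (y - (p, v))) \<le> e / 3 * norm (y - (p, v))"
    proof -
      have "e / 3 > 0" using \<open>e > 0\<close> by simp
      thus ?thesis
        using der that unfolding has_derivative_at_alt by (metis case_prod_conv)
    qed
    \<comment> \<open>From within \<rho> of (p, v), a move by \<rho> in direction i stays within
      2\<rho>, which is below both radii. Cauchy's estimate then gives (e/3)(2\<rho>)/\<rho> = 2e/3
      < e.\<close>
    define \<rho> where "\<rho> = min \<delta>1 \<delta>2 / 3"
    have \<rho>: "\<rho> > 0" "2 * \<rho> < \<delta>1" "2 * \<rho> < \<delta>2"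
      using \<delta>1(1) \<delta>2(1) by (auto simp: \<rho>_def)
    have "dist (partial i (f p') v') (partial i (f p) v) < e" if *: "dist (p', v') (p, v) < \<rho>" for p' v'
    proof -
      define g where "g w = f p' (upd i v' w) - f p v - L ((p', upd i v' w) - (p, v))" for w
      have near: "norm ((p', upd i v' w) - (p, v)) \<le> norm (w - v' $ i) + \<rho>" for w
      proof -
        have "(p', upd i v' w) - (p, v) = (0, axis i (w - v' $ i)) + ((p', v') - (p, v))"
          by (simp add: upd_eq_axis)
        also have "norm \<dots> \<le> norm (0 :: complex, axis i (w - v' $ i) :: complex^'a) + norm ((p', v') - (p, v))"
          by (rule norm_triangle_ineq)
        also have "norm (0 :: complex, axis i (w - v' $ i) :: complex^'a) = norm (w - v' $ i)"
          by (simp add: norm_Pair norm_axis)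
        finally show ?thesis using * by (simp add: dist_norm)
      qed
      have inG: "(p', upd i v' w) \<in> G" if "w \<in> cball (v' $ i) \<rho>" for w
        using that near[of w] \<delta>1(2) \<rho> by (auto simp: dist_norm norm_minus_commute subset_iff)
      have L: "L ((p', upd i v' w) - (p, v)) = L ((p', v') - (p, v)) + d i * (w - v' $ i)" for w
        by (simp add: L_def upd_eq_axis sum.distrib ring_distribs sum_axis right_diff_distrib sum_subtractf)
      have g': "(g has_field_derivative (partial i (f p') (upd i v' w) - d i)) (at w)"
        if "w \<in> cball (v' $ i) \<rho>" for w
        unfolding g_def L
        by (auto intro!: derivative_eq_intros joint_holomorphic_partial_upd[OF f] inG that)
      have "norm ((deriv ^^ 1) g (v' $ i)) \<le> fact 1 * (e / 3 * (2 * \<rho>)) / \<rho> ^ 1"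
      proof (rule Cauchy_inequality)
        show "continuous_on (cball (v' $ i) \<rho>) g"
          using g' DERIV_isCont continuous_at_imp_continuous_on by blast
        show "g holomorphic_on ball (v' $ i) \<rho>"
          using g' by (meson ball_subset_cball field_differentiable_at_within field_differentiable_def
              holomorphic_on_def subsetD)
        fix w assume w: "norm (v' $ i - w) = \<rho>"
        hence "norm ((p', upd i v' w) - (p, v)) \<le> 2 * \<rho>"
          using near[of w] by (simp add: norm_minus_commute)
        moreover from this have "norm (g w) \<le> e / 3 * norm ((p', upd i v' w) - (p, v))"
          using \<delta>2(2)[of "(p', upd i v' w)"] \<rho> by (simp add: g_def)
        ultimately show "norm (g w) \<le> e / 3 * (2 * \<rho>)"
          using \<open>e > 0\<close> by (meson divide_nonneg_nonneg le_less mult_left_mono order_trans zero_le_numeral)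
      qed (use \<rho> in auto)
      moreover have "deriv g (v' $ i) = partial i (f p') v' - d i"
        using g'[of "v' $ i"] \<rho> DERIV_imp_deriv by fastforce
      ultimately have "norm (partial i (f p') v' - d i) \<le> e / 3 * 2"
        using \<rho> by simp
      thus ?thesis using \<open>e > 0\<close> by (simp add: dist_norm d_def)
    qed
    thus "\<exists>d>0. \<forall>x'. dist x' (p, v) < d \<longrightarrow>
        dist (case x' of (p, v) \<Rightarrow> partial i (f p) v) (case (p, v) of (p, v) \<Rightarrow> partial i (f p) v) < e"
      using \<rho>(1) by auto
  qed
qed

section \<open>Differentiating Cauchy integrals\<close>

text \<open>In the circle's own parameter the contour integral is an ordinary integral over [0,1],
  weighted by the velocity \<open>k\<close> of the circle, so the Leibniz rule for parameter
  integrals applies.\<close>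

lemma contour_integral_circlepath_has_field_derivative:
  fixes f :: "complex \<Rightarrow> complex \<Rightarrow> complex"
  assumes B: "open B" "convex B" "w0 \<in> B" and "0 \<le> \<rho>"
    and der: "\<And>\<zeta> w. \<zeta> \<in> sphere c \<rho> \<Longrightarrow> w \<in> B \<Longrightarrow> (f \<zeta> has_field_derivative f' \<zeta> w) (at w)"
    and cont: "\<And>w. w \<in> B \<Longrightarrow> continuous_on (sphere c \<rho>) (\<lambda>\<zeta>. f \<zeta> w)"
    and cont': "continuous_on (sphere c \<rho> \<times> B) (\<lambda>(\<zeta>, w). f' \<zeta> w)"
  shows "((\<lambda>w. contour_integral (circlepath c \<rho>) (\<lambda>\<zeta>. f \<zeta> w)) has_field_derivative
          contour_integral (circlepath c \<rho>) (\<lambda>\<zeta>. f' \<zeta> w0)) (at w0)"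
proof -
  define \<gamma> where "\<gamma> = circlepath c \<rho>"
  define k where "k = (\<lambda>t::real. 2 * pi * \<i> * \<rho> * exp (2 * of_real pi * \<i> * t))"
  have \<gamma>: "continuous_on {0..1} \<gamma>" "\<And>t. t \<in> {0..1} \<Longrightarrow> \<gamma> t \<in> sphere c \<rho>"
    using path_image_circlepath_nonneg[OF \<open>0 \<le> \<rho>\<close>, of c] path_circlepath[of c \<rho>]
    by (auto simp: \<gamma>_def path_def path_image_def)
  have k: "continuous_on A k" for A
    unfolding k_def by (intro continuous_intros)
  have "((\<lambda>w. integral (cbox 0 1) (\<lambda>t. f (\<gamma> t) w * k t)) has_field_derivative
      integral (cbox 0 1) (\<lambda>t. f' (\<gamma> t) w0 * k t)) (at w0 within B)"
  proof (rule leibniz_rule_field_derivative)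
    fix w :: complex and t :: real assume "w \<in> B" "t \<in> cbox 0 1"
    thus "((\<lambda>w. f (\<gamma> t) w * k t) has_field_derivative f' (\<gamma> t) w * k t) (at w within B)"
      using \<gamma>(2) by (auto intro!: DERIV_cmult_right has_field_derivative_at_within[OF der])
  next
    fix w assume "w \<in> B"
    have "continuous_on (cbox 0 1) (\<lambda>t. f (\<gamma> t) w * k t)"
      by (intro continuous_intros k continuous_on_compose2[OF cont[OF \<open>w \<in> B\<close>]]) (use \<gamma> in auto)
    thus "(\<lambda>t. f (\<gamma> t) w * k t) integrable_on cbox 0 1"
      by (rule integrable_continuous)
  next
    have "continuous_on (B \<times> cbox 0 1) (\<lambda>x. (\<lambda>(\<zeta>, w). f' \<zeta> w) (\<gamma> (snd x), fst x) * k (snd x))"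
      by (intro continuous_intros continuous_on_compose2[OF cont'] continuous_on_compose2[OF k[of UNIV]]
            continuous_on_compose2[OF \<gamma>(1)]) (use \<gamma> in auto)
    thus "continuous_on (B \<times> cbox 0 1) (\<lambda>(w, t). f' (\<gamma> t) w * k t)"
      by (simp add: case_prod_unfold)
  qed (use B in auto)
  thus ?thesis
    unfolding contour_integral_integral vector_derivative_circlepath \<gamma>_def k_def
      at_within_open[OF B(3,1)] cbox_interval .
qed

text \<open>The Leibniz rule needs one disc of parameters that is valid for all \<zeta> at once.
  Compactness of the circle provides it through the tube lemma; continuity of the differentiated
  integrand is \<open>joint_holomorphic_continuous_partial\<close>.\<close>

lemma joint_holomorphic_contour_integral_partial:
  fixes f :: "complex \<Rightarrow> complex^'n \<Rightarrow> complex"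
  assumes f: "joint_holomorphic_on f G" and "open G" and sub: "\<And>\<zeta>. \<zeta> \<in> sphere c \<rho> \<Longrightarrow> (\<zeta>, v) \<in> G"
    and "0 \<le> \<rho>" and h: "continuous_on (sphere c \<rho>) h"
  shows "((\<lambda>w. contour_integral (circlepath c \<rho>) (\<lambda>\<zeta>. f \<zeta> (upd i v w) * h \<zeta>)) has_field_derivative
          contour_integral (circlepath c \<rho>) (\<lambda>\<zeta>. partial i (f \<zeta>) v * h \<zeta>)) (at (v $ i))"
proof -
  have cu: "continuous_on A (\<lambda>x. (snd x, upd i v (fst x)))" for A
    by (intro continuous_intros continuous_on_compose2[OF continuous_upd[of UNIV]]) auto
  have opn: "open ((\<lambda>x. (snd x, upd i v (fst x))) -` G)"
    by (rule open_vimage[OF \<open>open G\<close> cu])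
  have "{v $ i} \<times> sphere c \<rho> \<subseteq> (\<lambda>x. (snd x, upd i v (fst x))) -` G"
    using sub by auto
  from Elementary_Topology.tube_lemma[OF compact_sphere opn this] obtain X where X: "v $ i \<in> X" "open X"
      "X \<times> sphere c \<rho> \<subseteq> (\<lambda>x. (snd x, upd i v (fst x))) -` G"
    by blast
  obtain d where d: "d > 0" "ball (v $ i) d \<subseteq> X"
    using X open_contains_ball by blast
  have inG: "(\<zeta>, upd i v w) \<in> G" if "\<zeta> \<in> sphere c \<rho>" "w \<in> ball (v $ i) d" for \<zeta> w
  proof -
    have "(w, \<zeta>) \<in> X \<times> sphere c \<rho>" using that d by blast
    from subsetD[OF X(3) this] show ?thesis by simp
  qed
  have cont: "continuous_on (sphere c \<rho>) (\<lambda>\<zeta>. f \<zeta> (upd i v w) * h \<zeta>)" if "w \<in> ball (v $ i) d" for w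
  proof -
    have "continuous_on (sphere c \<rho>) (\<lambda>\<zeta>. (\<lambda>(p, v). f p v) (\<zeta>, upd i v w))"
      by (rule continuous_on_compose2[OF joint_holomorphic_continuous[OF f]])
         (use inG that in \<open>auto intro!: continuous_intros\<close>)
    thus ?thesis using h by (auto intro: continuous_on_mult)
  qed
  have cont': "continuous_on (sphere c \<rho> \<times> ball (v $ i) d) (\<lambda>(\<zeta>, w). partial i (f \<zeta>) (upd i v w) * h \<zeta>)"
  proof -
    have "continuous_on (sphere c \<rho> \<times> ball (v $ i) d)
        (\<lambda>x. (\<lambda>(p, v). partial i (f p) v) (fst x, upd i v (snd x)))"
      by (rule continuous_on_compose2[OF joint_holomorphic_continuous_partial[OF f \<open>open G\<close>]])
         (use inG in \<open>auto intro!: continuous_intros continuous_on_compose2[OF continuous_upd[of UNIV]]\<close>)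
    moreover have "continuous_on (sphere c \<rho> \<times> ball (v $ i) d) (\<lambda>x. h (fst x))"
      by (rule continuous_on_compose2[OF h]) (auto intro: continuous_intros)
    ultimately show ?thesis by (auto simp: case_prod_unfold intro: continuous_on_mult)
  qed
  have "((\<lambda>w. contour_integral (circlepath c \<rho>) (\<lambda>\<zeta>. f \<zeta> (upd i v w) * h \<zeta>)) has_field_derivative
      contour_integral (circlepath c \<rho>) (\<lambda>\<zeta>. partial i (f \<zeta>) (upd i v (v $ i)) * h \<zeta>)) (at (v $ i))"
    by (rule contour_integral_circlepath_has_field_derivative[where B = "ball (v $ i) d"])
       (use d assms inG cont cont' in \<open>auto intro!: DERIV_cmult_right joint_holomorphic_partial_upd\<close>)
  thus ?thesis by simp
qed

text \<open>The point y may lie on either side of the circle: polynomial parts are evaluated inside,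
  singular parts outside.\<close>

lemma Cauchy_kernel_has_field_derivative:
  assumes f: "continuous_on (sphere c \<rho>) f" and "y \<notin> sphere c \<rho>" "0 \<le> \<rho>"
  shows "((\<lambda>y. contour_integral (circlepath c \<rho>) (\<lambda>\<zeta>. f \<zeta> / (\<zeta> - y))) has_field_derivative
          contour_integral (circlepath c \<rho>) (\<lambda>\<zeta>. f \<zeta> / (\<zeta> - y)\<^sup>2)) (at y)"
proof -
  have pi: "path_image (circlepath c \<rho>) = sphere c \<rho>"
    using assms by (simp add: path_image_circlepath_nonneg)
  have "((\<lambda>y. contour_integral (circlepath c \<rho>) (\<lambda>\<zeta>. f \<zeta> / (\<zeta> - y) ^ 1)) has_field_derivative
        of_nat 1 * contour_integral (circlepath c \<rho>) (\<lambda>\<zeta>. f \<zeta> / (\<zeta> - y) ^ Suc 1)) (at y)"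
  \<comment> \<open>\<open>B\<close> is the constant speed of the circle path.\<close>
  proof (rule Cauchy_next_derivative(2)[where S = UNIV and B = "2 * pi * \<rho>"])
    fix w assume "w \<in> UNIV - path_image (circlepath c \<rho>)"
    hence "continuous_on (sphere c \<rho>) (\<lambda>\<zeta>. f \<zeta> / (\<zeta> - w) ^ 1)"
      using f pi by (auto intro!: continuous_intros)
    thus "((\<lambda>\<zeta>. f \<zeta> / (\<zeta> - w) ^ 1) has_contour_integral
        contour_integral (circlepath c \<rho>) (\<lambda>\<zeta>. f \<zeta> / (\<zeta> - w) ^ 1)) (circlepath c \<rho>)"
      using pi by (intro has_contour_integral_integral contour_integrable_continuous_circlepath) auto
  qed (use assms pi in \<open>auto simp: vector_derivative_circlepath norm_mult\<close>)
  thus ?thesis by (simp add: numeral_2_eq_2)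
qed

text \<open>Integration by parts: f(\<zeta>)/(\<zeta> - y) is a primitive of the difference of the
  integrands, and on a closed path its boundary terms cancel.\<close>

lemma contour_integral_deriv_Cauchy_kernel:
  assumes f: "f holomorphic_on S" and S: "open S" "sphere c \<rho> \<subseteq> S" and y: "y \<notin> sphere c \<rho>" and "0 \<le> \<rho>"
  shows "contour_integral (circlepath c \<rho>) (\<lambda>\<zeta>. deriv f \<zeta> / (\<zeta> - y)) =
         contour_integral (circlepath c \<rho>) (\<lambda>\<zeta>. f \<zeta> / (\<zeta> - y)\<^sup>2)"
proof -
  have pi: "path_image (circlepath c \<rho>) = sphere c \<rho>"
    using assms by (simp add: path_image_circlepath_nonneg)
  have cont: "continuous_on (sphere c \<rho>) f" "continuous_on (sphere c \<rho>) (deriv f)"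
    using f S holomorphic_deriv[OF f] by (auto intro: holomorphic_on_imp_continuous_on continuous_on_subset)
  have "((\<lambda>\<zeta>. deriv f \<zeta> / (\<zeta> - y) - f \<zeta> / (\<zeta> - y)\<^sup>2) has_contour_integral
      f (pathfinish (circlepath c \<rho>)) / (pathfinish (circlepath c \<rho>) - y) -
      f (pathstart (circlepath c \<rho>)) / (pathstart (circlepath c \<rho>) - y)) (circlepath c \<rho>)"
  proof (rule contour_integral_primitive[where S = "S - {y}"])
    fix x assume x: "x \<in> S - {y}"
    hence "(f has_field_derivative deriv f x) (at x within S - {y})"
      using f S by (meson DiffD1 has_field_derivative_at_within holomorphic_derivI)
    thus "((\<lambda>\<zeta>. f \<zeta> / (\<zeta> - y)) has_field_derivative deriv f x / (x - y) - f x / (x - y)\<^sup>2) (at x within S - {y})"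
      using x by (auto intro!: derivative_eq_intros simp: diff_divide_distrib power2_eq_square)
  qed (use S y pi in auto)
  hence "contour_integral (circlepath c \<rho>) (\<lambda>\<zeta>. deriv f \<zeta> / (\<zeta> - y) - f \<zeta> / (\<zeta> - y)\<^sup>2) = 0"
    by (simp add: contour_integral_unique)
  moreover have "(\<lambda>\<zeta>. deriv f \<zeta> / (\<zeta> - y)) contour_integrable_on circlepath c \<rho>"
      "(\<lambda>\<zeta>. f \<zeta> / (\<zeta> - y)\<^sup>2) contour_integrable_on circlepath c \<rho>"
    using y pi by (auto intro!: contour_integrable_continuous_circlepath continuous_intros cont)
  ultimately show ?thesis
    by (simp add: contour_integral_diff)
qed

text \<open>Partial fractions turn the integral of \<open>\<Sum> r\<^sub>k / (\<zeta> - b\<^sub>k) * Z' \<zeta> / (\<zeta> - p)\<close>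
  into Cauchy integrals of \<open>Z'\<close> at the points \<open>b\<^sub>k\<close> and \<open>p\<close>.\<close>

lemma Cauchy_part_transport:
  fixes Z \<Omega> :: "complex \<Rightarrow> complex^'n \<Rightarrow> complex" and r b :: "'n \<Rightarrow> complex"
  assumes Z: "joint_holomorphic_on Z G" and "open G" and sub: "\<And>\<zeta>. \<zeta> \<in> sphere c \<rho> \<Longrightarrow> (\<zeta>, v) \<in> G"
    and "0 \<le> \<rho>"
    and pde: "\<And>\<zeta>. \<zeta> \<in> sphere c \<rho> \<Longrightarrow>
      partial i (Z \<zeta>) v + (\<Sum>k\<in>UNIV. r k / (\<zeta> - b k)) * deriv (\<lambda>x. Z x v) \<zeta> = 0"
    and E: "open E" "E \<inter> sphere c \<rho> = {}" "\<And>k. b k \<in> E" "p \<in> E"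
    and rep: "eventually (\<lambda>w. \<forall>y\<in>E. \<Omega> y w =
      \<kappa> * contour_integral (circlepath c \<rho>) (\<lambda>\<zeta>. Z \<zeta> w / (\<zeta> - y))) (nhds v)"
    and r0: "\<And>k. b k = p \<Longrightarrow> r k = 0"
  shows "partial i (\<Omega> p) v + (\<Sum>k\<in>UNIV. r k / (p - b k)) * deriv (\<lambda>x. \<Omega> x v) p =
         (\<Sum>k\<in>UNIV. r k / (p - b k) * deriv (\<lambda>x. \<Omega> x v) (b k))"
proof -
  \<comment> \<open>Up to \<kappa>, \<open>J\<close> is the p-derivative of \<Omega>, with the
    derivative moved from the kernel to Z. In the applications \<open>E\<close> is the inside of the
    circle with \<kappa> = 1/(2\<pi>i), or the outside with the opposite sign.\<close>
  define J where "J y = contour_integral (circlepath c \<rho>) (\<lambda>\<zeta>. deriv (\<lambda>x. Z x v) \<zeta> / (\<zeta> - y))" for y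
  have pi: "path_image (circlepath c \<rho>) = sphere c \<rho>"
    using assms by (simp add: path_image_circlepath_nonneg)
  define S where "S = {x. (x, v) \<in> G}"
  have "open ((\<lambda>x. (x, v)) -` G)"
    by (rule open_vimage[OF \<open>open G\<close>]) (intro continuous_intros)
  hence S: "open S" "sphere c \<rho> \<subseteq> S"
    using sub by (auto simp: S_def vimage_def)
  have holo: "(\<lambda>x. Z x v) holomorphic_on S"
    by (rule joint_holomorphic_slice[OF Z]) (simp add: S_def)
  have cont: "continuous_on (sphere c \<rho>) (\<lambda>x. Z x v)" "continuous_on (sphere c \<rho>) (deriv (\<lambda>x. Z x v))"
    using holo S holomorphic_deriv[OF holo] by (auto intro: holomorphic_on_imp_continuous_on continuous_on_subset)
  have ns: "y \<notin> sphere c \<rho>" if "y \<in> E" for y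
    using that E by blast
  have deriv\<Omega>: "deriv (\<lambda>x. \<Omega> x v) y = \<kappa> * J y" if y: "y \<in> E" for y
  proof -
    have "((\<lambda>y. \<kappa> * contour_integral (circlepath c \<rho>) (\<lambda>\<zeta>. Z \<zeta> v / (\<zeta> - y))) has_field_derivative
        \<kappa> * contour_integral (circlepath c \<rho>) (\<lambda>\<zeta>. Z \<zeta> v / (\<zeta> - y)\<^sup>2)) (at y)"
      by (intro DERIV_cmult Cauchy_kernel_has_field_derivative cont ns y \<open>0 \<le> \<rho>\<close>)
    also have "contour_integral (circlepath c \<rho>) (\<lambda>\<zeta>. Z \<zeta> v / (\<zeta> - y)\<^sup>2) = J y"
      unfolding J_def using contour_integral_deriv_Cauchy_kernel[OF holo S ns[OF y] \<open>0 \<le> \<rho>\<close>] by simp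
    finally have "((\<lambda>x. \<Omega> x v) has_field_derivative \<kappa> * J y) (at y)"
      by (rule has_field_derivative_transform_within_open[OF _ E(1) y])
         (use eventually_nhds_x_imp_x[OF rep] in simp)
    thus ?thesis by (rule DERIV_imp_deriv)
  qed
  have "partial i (\<Omega> p) v = \<kappa> * contour_integral (circlepath c \<rho>) (\<lambda>\<zeta>. partial i (Z \<zeta>) v * (1 / (\<zeta> - p)))"
  proof -
    \<comment> \<open>The integral representation is known only for parameters near v, so it is
      pulled back along the slice before differentiating.\<close>
    have "isCont (upd i v) (v $ i)"
      by (rule has_derivative_continuous[OF upd_has_derivative])
    hence "filterlim (upd i v) (nhds v) (nhds (v $ i))"
      using tendsto_at_iff_tendsto_nhds[of "upd i v" "v $ i"] by (simp add: isCont_def)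
    hence ev: "eventually (\<lambda>x. \<Omega> p (upd i v x) =
        \<kappa> * contour_integral (circlepath c \<rho>) (\<lambda>\<zeta>. Z \<zeta> (upd i v x) * (1 / (\<zeta> - p)))) (nhds (v $ i))"
      by (rule eventually_mono[OF eventually_compose_filterlim[OF rep]]) (simp add: E(4))
    have "((\<lambda>x. \<kappa> * contour_integral (circlepath c \<rho>) (\<lambda>\<zeta>. Z \<zeta> (upd i v x) * (1 / (\<zeta> - p)))) has_field_derivative
        \<kappa> * contour_integral (circlepath c \<rho>) (\<lambda>\<zeta>. partial i (Z \<zeta>) v * (1 / (\<zeta> - p)))) (at (v $ i))"
    proof (rule DERIV_cmult, rule joint_holomorphic_contour_integral_partial[OF Z \<open>open G\<close> sub \<open>0 \<le> \<rho>\<close>])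
      show "continuous_on (sphere c \<rho>) (\<lambda>\<zeta>. 1 / (\<zeta> - p))"
        using ns[OF E(4)] by (auto intro!: continuous_intros)
    qed
    hence "((\<lambda>x. \<Omega> p (upd i v x)) has_field_derivative
        \<kappa> * contour_integral (circlepath c \<rho>) (\<lambda>\<zeta>. partial i (Z \<zeta>) v * (1 / (\<zeta> - p)))) (at (v $ i))"
      using DERIV_cong_ev[OF refl ev refl] by simp
    thus ?thesis
      unfolding partial_eq_deriv_upd[of i "\<Omega> p"] by (rule DERIV_imp_deriv)
  qed
  also have "contour_integral (circlepath c \<rho>) (\<lambda>\<zeta>. partial i (Z \<zeta>) v * (1 / (\<zeta> - p))) =
      contour_integral (circlepath c \<rho>) (\<lambda>\<zeta>. \<Sum>k\<in>UNIV. r k / (p - b k) *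
        (deriv (\<lambda>x. Z x v) \<zeta> / (\<zeta> - b k) - deriv (\<lambda>x. Z x v) \<zeta> / (\<zeta> - p)))"
  proof (rule contour_integral_eq)
    fix \<zeta> assume "\<zeta> \<in> path_image (circlepath c \<rho>)"
    hence \<zeta>: "\<zeta> \<in> sphere c \<rho>" by (simp only: pi)
    have nz: "\<zeta> \<noteq> b k" "\<zeta> \<noteq> p" for k
      using \<zeta> ns[OF E(3)] ns[OF E(4)] by blast+
    have "partial i (Z \<zeta>) v = - (\<Sum>k\<in>UNIV. r k / (\<zeta> - b k)) * deriv (\<lambda>x. Z x v) \<zeta>"
      using pde[OF \<zeta>] by (simp only: mult_minus_left eq_neg_iff_add_eq_0)
    hence "partial i (Z \<zeta>) v * (1 / (\<zeta> - p)) =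
        (\<Sum>k\<in>UNIV. - (r k / (\<zeta> - b k)) * deriv (\<lambda>x. Z x v) \<zeta> * (1 / (\<zeta> - p)))"
      by (simp add: sum_distrib_right sum_negf sum_divide_distrib)
    also have "\<dots> = (\<Sum>k\<in>UNIV. r k / (p - b k) *
        (deriv (\<lambda>x. Z x v) \<zeta> / (\<zeta> - b k) - deriv (\<lambda>x. Z x v) \<zeta> / (\<zeta> - p)))"
    proof (rule sum.cong)
      fix k
      show "- (r k / (\<zeta> - b k)) * deriv (\<lambda>x. Z x v) \<zeta> * (1 / (\<zeta> - p)) = r k / (p - b k) *
        (deriv (\<lambda>x. Z x v) \<zeta> / (\<zeta> - b k) - deriv (\<lambda>x. Z x v) \<zeta> / (\<zeta> - p))"
      \<comment> \<open>Partial fractions of 1/((\<zeta> - b_k)(\<zeta> - p)) require distinct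
        points; when they coincide, \<open>r0\<close> makes both sides zero.\<close>
      proof (cases "b k = p")
        case False
        hence "p - b k \<noteq> 0" "\<zeta> - b k \<noteq> 0" "\<zeta> - p \<noteq> 0" using nz by auto
        thus ?thesis by (simp add: divide_simps) (simp add: algebra_simps)
      qed (simp add: r0)
    qed simp
    finally show "partial i (Z \<zeta>) v * (1 / (\<zeta> - p)) = \<dots>" .
  qed
  also have "\<dots> = (\<Sum>k\<in>UNIV. r k / (p - b k) * (J (b k) - J p))"
  proof -
    have int: "(\<lambda>\<zeta>. deriv (\<lambda>x. Z x v) \<zeta> / (\<zeta> - y)) contour_integrable_on circlepath c \<rho>" if "y \<in> E" for y
      using ns[OF that] pi by (auto intro!: contour_integrable_continuous_circlepath continuous_intros cont)
    show ?thesis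
      unfolding J_def
      by (intro contour_integral_unique has_contour_integral_sum has_contour_integral_lmul
          has_contour_integral_diff has_contour_integral_integral int E finite_class.finite_UNIV)
  qed
  finally have *: "partial i (\<Omega> p) v = \<kappa> * (\<Sum>k\<in>UNIV. r k / (p - b k) * (J (b k) - J p))" .
  \<comment> \<open>The \<open>J p\<close> terms amount to minus R_i(p) times the p-derivative of
    \<Omega>, so they cancel the second summand on the left.\<close>
  show ?thesis
    unfolding * deriv\<Omega>[OF E(3)] deriv\<Omega>[OF E(4)] sum_distrib_left sum_distrib_right
      sum.distrib[symmetric]
    by (rule sum.cong) (simp_all add: ring_distribs mult.left_commute right_diff_distrib)
qed

section \<open>Polynomial and singular parts as Cauchy integrals\<close>

text \<open>As a formal series \<open>Q\<close>, the principal part cancels all negative powers of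
  \<open>L\<close>. Since \<open>fls_prpart\<close> has no constant term, the coefficient of order 0
  is left intact and becomes the limit.\<close>

lemma laurent_minus_principal_part_tendsto:
  assumes "F has_laurent_expansion L"
  shows "((\<lambda>w. F w - poly (fls_prpart L) (1 / w)) \<longlongrightarrow> fls_nth L 0) (at 0)"
proof -
  define p where "p = fls_prpart L"
  define Q where "Q = (\<Sum>m\<le>degree p. fls_const (coeff p m) * fls_X_intpow (- int m))"
  have "(\<lambda>w. \<Sum>m\<le>degree p. coeff p m * w powi (- int m)) has_laurent_expansion Q"
    unfolding Q_def
    by (intro has_laurent_expansion_sum has_laurent_expansion_cmult_left has_laurent_expansion_fps_X_power_int)
  also have "(\<lambda>w. \<Sum>m\<le>degree p. coeff p m * w powi (- int m)) = (\<lambda>w. poly p (1 / w))"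
    by (simp add: poly_altdef power_int_minus power_one_over field_simps)
  finally have G: "(\<lambda>w. F w - poly p (1 / w)) has_laurent_expansion L - Q"
    by (rule has_laurent_expansion_diff[OF assms])
  have Q: "fls_nth Q n = (if n \<le> 0 then coeff p (nat (- n)) else 0)" for n
  proof -
    have "fls_nth Q n = (\<Sum>m\<le>degree p. if m = nat (- n) then (if n \<le> 0 then coeff p m else 0) else 0)"
      unfolding Q_def fls_nth_sum by (intro sum.cong) auto
    also have "\<dots> = (if n \<le> 0 then coeff p (nat (- n)) else 0)"
      by (simp add: coeff_eq_0)
    finally show ?thesis .
  qed
  have "fls_subdegree (L - Q) \<ge> 0"
    by (rule fls_subdegree_ge0I) (simp add: Q p_def)
  from has_laurent_expansion_imp_tendsto_0[OF G this] show ?thesis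
    by (simp add: Q p_def)
qed

text \<open>The base case is Cauchy's formula with the roles exchanged: 1/(\<zeta> - y) is
  holomorphic in the disc and is evaluated at q. Each further power of 1/(\<zeta> - q) is split off
  by partial fractions.\<close>

lemma has_contour_integral_pole_power_Cauchy_kernel:
  assumes q: "q \<in> ball c \<rho>" and y: "y \<notin> cball c \<rho>"
  shows "((\<lambda>\<zeta>. (1 / (\<zeta> - q)) ^ Suc m / (\<zeta> - y)) has_contour_integral
           - (2 * pi * \<i> * (1 / (y - q)) ^ Suc m)) (circlepath c \<rho>)"
proof (induction m)
  case 0
  have "((\<lambda>\<zeta>. (1 / (\<zeta> - y)) / (\<zeta> - q)) has_contour_integral 2 * of_real pi * \<i> * (1 / (q - y))) (circlepath c \<rho>)"
    by (rule Cauchy_integral_circlepath)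
       (use q y in \<open>auto intro!: continuous_intros holomorphic_intros simp: dist_norm norm_minus_commute\<close>)
  moreover have "2 * of_real pi * \<i> * (1 / (q - y)) = - (2 * pi * \<i> * (1 / (y - q)) ^ Suc 0)"
    by (simp add: minus_divide_right)
  ultimately show ?case by (simp add: mult.commute)
next
  case (Suc m)
  have "q \<noteq> y" using q y by auto
  \<comment> \<open>Powers of order at least two have no residue: Cauchy's formula yields a
    derivative of the constant 1.\<close>
  have "((\<lambda>\<zeta>. 1 / (\<zeta> - q) ^ Suc (Suc m)) has_contour_integral
      2 * pi * \<i> / fact (Suc m) * (deriv ^^ Suc m) (\<lambda>_. 1) q) (circlepath c \<rho>)"
    by (rule Cauchy_has_contour_integral_higher_derivative_circlepath)
       (use q in \<open>auto intro!: continuous_intros holomorphic_intros\<close>)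
  hence "((\<lambda>\<zeta>. (1 / (\<zeta> - q)) ^ Suc (Suc m)) has_contour_integral 0) (circlepath c \<rho>)"
    by (simp only: higher_deriv_const power_one_over) simp
  from has_contour_integral_lmul[OF has_contour_integral_diff[OF Suc this], of "1 / (y - q)"]
  have "((\<lambda>\<zeta>. 1 / (y - q) * ((1 / (\<zeta> - q)) ^ Suc m / (\<zeta> - y) - (1 / (\<zeta> - q)) ^ Suc (Suc m)))
      has_contour_integral - (2 * pi * \<i> * (1 / (y - q)) ^ Suc (Suc m))) (circlepath c \<rho>)"
    by (simp add: field_simps)
  moreover have "1 / (y - q) * ((1 / (\<zeta> - q)) ^ Suc m / (\<zeta> - y) - (1 / (\<zeta> - q)) ^ Suc (Suc m)) =
      (1 / (\<zeta> - q)) ^ Suc (Suc m) / (\<zeta> - y)" if "\<zeta> \<in> path_image (circlepath c \<rho>)" for \<zeta>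
  proof -
    have "\<rho> > 0" using q zero_le_dist[of c q] by (simp del: zero_le_dist)
    hence "\<zeta> \<noteq> q" "\<zeta> \<noteq> y" using that q y by auto
    define A where "A = (1 / (\<zeta> - q)) ^ Suc m"
    have "1 / (y - q) * (A / (\<zeta> - y) - A * (1 / (\<zeta> - q))) = A * (1 / (\<zeta> - q)) / (\<zeta> - y)"
      using \<open>\<zeta> \<noteq> q\<close> \<open>\<zeta> \<noteq> y\<close> \<open>q \<noteq> y\<close> by (simp add: divide_simps) (simp add: algebra_simps)
    thus ?thesis by (simp add: A_def mult.commute)
  qed
  ultimately show ?case
    by (rule has_contour_integral_eq)
qed

text \<open>Off its principal part f extends holomorphically over q, and that rest integrates to 0
  against the kernel because y is outside. The circle need not be centred at q, which lets it stay
  fixed while the pole moves with u.\<close>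

lemma contour_integral_singular_part:
  assumes S: "open S" "cball c \<rho> \<subseteq> S" and q: "q \<in> ball c \<rho>" and y: "y \<notin> cball c \<rho>"
    and holo: "f holomorphic_on S - {q}" and ness: "not_essential f q"
  shows "contour_integral (circlepath c \<rho>) (\<lambda>\<zeta>. f \<zeta> / (\<zeta> - y)) = - (2 * pi * \<i> * singular_part f q y)"
proof -
  define L where "L = laurent_expansion f q"
  define p where "p = fls_prpart L"
  have "q \<in> S" using S q by auto
  have "\<rho> > 0" using q zero_le_dist[of c q] by (simp del: zero_le_dist)
  hence pi: "path_image (circlepath c \<rho>) = sphere c \<rho>" by simp
  have "(\<lambda>x. f (q + x)) has_laurent_expansion L"
    unfolding L_def
    by (intro not_essential_has_laurent_expansion isolated_singularity_at_holomorphic[OF holo S(1) \<open>q \<in> S\<close>] ness)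
  from laurent_minus_principal_part_tendsto[OF this]
  have lim: "((\<lambda>x. f x - poly p (1 / (x - q))) \<longlongrightarrow> fls_nth L 0) (at q)"
    by (simp add: at_to_0[of q] filterlim_filtermap add_ac p_def)
  define g where "g = (\<lambda>x. if x = q then fls_nth L 0 else f x - poly p (1 / (x - q)))"
  have g: "g holomorphic_on S"
    unfolding g_def
    by (rule removable_singularity[OF _ S(1) lim]) (auto intro!: holomorphic_intros holo)
  have "((\<lambda>\<zeta>. g \<zeta> / (\<zeta> - y)) has_contour_integral 0) (circlepath c \<rho>)"
    by (rule Cauchy_theorem_convex_simple[where S = "cball c \<rho>"])
       (use pi y S g in \<open>auto intro!: holomorphic_intros intro: holomorphic_on_subset\<close>)
  moreover have "((\<lambda>\<zeta>. \<Sum>m\<le>degree p. coeff p m * ((1 / (\<zeta> - q)) ^ m / (\<zeta> - y))) has_contour_integral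
      (\<Sum>m\<le>degree p. coeff p m * - (2 * pi * \<i> * (1 / (y - q)) ^ m))) (circlepath c \<rho>)"
  proof (rule has_contour_integral_sum)
    fix m
    show "((\<lambda>\<zeta>. coeff p m * ((1 / (\<zeta> - q)) ^ m / (\<zeta> - y))) has_contour_integral
        coeff p m * - (2 * pi * \<i> * (1 / (y - q)) ^ m)) (circlepath c \<rho>)"
    proof (cases m)
      \<comment> \<open>The formula used for positive exponents fails for exponent 0, but the
        coefficient there is 0.\<close>
      case 0
      thus ?thesis by (simp add: p_def has_contour_integral_0)
    next
      case (Suc k)
      show ?thesis
        unfolding Suc
        by (intro has_contour_integral_lmul has_contour_integral_pole_power_Cauchy_kernel q y)
    qed
  qed simp
  ultimately have "((\<lambda>\<zeta>. (\<Sum>m\<le>degree p. coeff p m * ((1 / (\<zeta> - q)) ^ m / (\<zeta> - y))) + g \<zeta> / (\<zeta> - y))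
      has_contour_integral (\<Sum>m\<le>degree p. coeff p m * - (2 * pi * \<i> * (1 / (y - q)) ^ m)) + 0) (circlepath c \<rho>)"
    by (intro has_contour_integral_add)
  hence "((\<lambda>\<zeta>. f \<zeta> / (\<zeta> - y)) has_contour_integral
      (\<Sum>m\<le>degree p. coeff p m * - (2 * pi * \<i> * (1 / (y - q)) ^ m)) + 0) (circlepath c \<rho>)"
  proof (rule has_contour_integral_eq)
    fix \<zeta> assume "\<zeta> \<in> path_image (circlepath c \<rho>)"
    hence "\<zeta> \<noteq> q" using pi q by auto
    have "(\<Sum>m\<le>degree p. coeff p m * ((1 / (\<zeta> - q)) ^ m / (\<zeta> - y))) = poly p (1 / (\<zeta> - q)) / (\<zeta> - y)"
      by (simp add: poly_altdef sum_divide_distrib)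
    thus "(\<Sum>m\<le>degree p. coeff p m * ((1 / (\<zeta> - q)) ^ m / (\<zeta> - y))) + g \<zeta> / (\<zeta> - y) = f \<zeta> / (\<zeta> - y)"
      using \<open>\<zeta> \<noteq> q\<close> by (simp add: g_def diff_divide_distrib)
  qed
  hence "contour_integral (circlepath c \<rho>) (\<lambda>\<zeta>. f \<zeta> / (\<zeta> - y)) =
      (\<Sum>m\<le>degree p. coeff p m * - (2 * pi * \<i> * (1 / (y - q)) ^ m))"
    by (simp add: contour_integral_unique)
  also have "\<dots> = - (2 * pi * \<i> * singular_part f q y)"
    unfolding singular_part_def L_def[symmetric] p_def[symmetric] poly_altdef sum_distrib_left sum_negf[symmetric]
    by (intro sum.cong) (simp_all add: mult_ac)
  finally show ?thesis .
qed

text \<open>The substitution \<zeta> = 1/w reverses the orientation of the circle and contributes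
  the factor -1/w^2; the two signs cancel.\<close>

lemma contour_integral_circlepath_reciprocal:
  assumes "\<rho> > 0"
  shows "contour_integral (circlepath 0 \<rho>) h = contour_integral (circlepath 0 (1 / \<rho>)) (\<lambda>w. h (1 / w) / w\<^sup>2)"
proof -
  define e where "e t = exp (2 * of_real pi * \<i> * complex_of_real t)" for t
  have rev: "reversepath (circlepath 0 (1 / \<rho>)) = (\<lambda>t. 1 / (complex_of_real \<rho> * e t))"
  proof
    fix t
    have "exp (2 * complex_of_real pi * \<i> * complex_of_real (1 - t)) = exp (2 * of_real pi * \<i> - 2 * of_real pi * \<i> * complex_of_real t)"
      by (simp add: algebra_simps)
    also have "\<dots> = 1 / e t"
      by (simp add: exp_diff e_def)
    finally show "reversepath (circlepath 0 (1 / \<rho>)) t = 1 / (complex_of_real \<rho> * e t)"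
      by (simp add: reversepath_def circlepath)
  qed
  have e': "(e has_vector_derivative 2 * of_real pi * \<i> * e t) (at t)" for t
    unfolding e_def
    by (auto intro!: derivative_eq_intros has_vector_derivative_real_field simp: o_def)
  have nz: "e t \<noteq> 0" for t by (simp add: e_def)
  have circ: "circlepath 0 \<rho> t = complex_of_real \<rho> * e t" for t
    by (simp add: circlepath e_def)
  have vd: "vector_derivative (\<lambda>t. 1 / (complex_of_real \<rho> * e t)) (at t) =
      - (2 * of_real pi * \<i>) / (\<rho> * e t)" for t
  proof (rule vector_derivative_at)
    have "((\<lambda>w. 1 / (complex_of_real \<rho> * exp (2 * of_real pi * \<i> * w))) has_field_derivative
        - (2 * of_real pi * \<i>) / (\<rho> * e t)) (at (complex_of_real t))"
      using assms by (auto intro!: derivative_eq_intros simp: e_def field_simps)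
    thus "((\<lambda>t. 1 / (complex_of_real \<rho> * e t)) has_vector_derivative - (2 * of_real pi * \<i>) / (\<rho> * e t)) (at t)"
      unfolding e_def by (rule has_vector_derivative_real_field)
  qed
  have "contour_integral (circlepath 0 (1 / \<rho>)) (\<lambda>w. h (1 / w) / w\<^sup>2) =
      - contour_integral (\<lambda>t. 1 / (complex_of_real \<rho> * e t)) (\<lambda>w. h (1 / w) / w\<^sup>2)"
    unfolding rev[symmetric] by (simp add: contour_integral_reversepath)
  also have "\<dots> = integral {0..1} (\<lambda>t. - (h (1 / (1 / (complex_of_real \<rho> * e t))) / (1 / (complex_of_real \<rho> * e t))\<^sup>2 *
      (- (2 * of_real pi * \<i>) / (\<rho> * e t))))"
    unfolding contour_integral_integral vd by (rule integral_neg[symmetric])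
  also have "\<dots> = integral {0..1} (\<lambda>t. h (circlepath 0 \<rho> t) * (2 * pi * \<i> * \<rho> * e t))"
    by (intro integral_cong) (use assms nz in \<open>simp add: circ field_simps power2_eq_square\<close>)
  also have "\<dots> = contour_integral (circlepath 0 \<rho>) h"
    unfolding contour_integral_integral vector_derivative_circlepath e_def ..
  finally show ?thesis ..
qed

text \<open>With w = 1/\<zeta>, the part of f that vanishes at infinity contributes the integral of
  g(w)/((1 - y w) w), where g is holomorphic and g(0) = 0, hence nothing. The polynomial part
  contributes by Cauchy's formula.\<close>

lemma contour_integral_polynomial_part:
  assumes R: "0 < R" "R < \<rho>" and y: "norm y < \<rho>"
    and holo: "f holomorphic_on {x. norm x > R}" and ness: "not_essential (\<lambda>w. f (1 / w)) 0"
  shows "contour_integral (circlepath 0 \<rho>) (\<lambda>\<zeta>. f \<zeta> / (\<zeta> - y)) = 2 * pi * \<i> * polynomial_part f y"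
proof -
  define L where "L = laurent_expansion (\<lambda>w. f (1 / w)) 0"
  define p where "p = fls_prpart L"
  define pp where "pp = (\<lambda>x. poly p x + fls_nth L 0)"
  have pp: "pp = polynomial_part f"
    unfolding pp_def p_def L_def by (simp add: fun_eq_iff polynomial_part_def Let_def)
  have holo': "(\<lambda>w. f (1 / w)) holomorphic_on ball 0 (1 / R) - {0}"
    by (rule holomorphic_on_compose_gen[OF _ holo, unfolded o_def])
       (use R in \<open>auto intro!: holomorphic_intros simp: norm_divide field_simps\<close>)
  have "(\<lambda>w. f (1 / w)) has_laurent_expansion L"
    unfolding L_def
    by (rule not_essential_has_laurent_expansion_0[OF isolated_singularity_at_holomorphic[OF holo'] ness])
       (use R in auto)
  from laurent_minus_principal_part_tendsto[OF this]
  have "((\<lambda>w. f (1 / w) - poly p (1 / w)) \<longlongrightarrow> fls_nth L 0) (at 0)"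
    by (simp add: p_def)
  from tendsto_diff[OF this tendsto_const[of "fls_nth L 0"]]
  have lim: "((\<lambda>w. f (1 / w) - pp (1 / w)) \<longlongrightarrow> 0) (at 0)"
    by (simp add: pp_def algebra_simps)
  \<comment> \<open>The value 0 is the right one because the polynomial part at infinity retains the
    constant term.\<close>
  define g where "g = (\<lambda>w. if w = 0 then 0 else f (1 / w) - pp (1 / w))"
  have g: "g holomorphic_on ball 0 (1 / R)"
    unfolding g_def
    by (rule removable_singularity[OF _ _ lim])
       (auto intro!: holomorphic_intros holo' simp: pp_def)
  have pi: "path_image (circlepath 0 \<rho>) = sphere 0 \<rho>" "path_image (circlepath 0 (1 / \<rho>)) = sphere 0 (1 / \<rho>)"
    using R by simp_all
  have "((\<lambda>w. (g w / (1 - y * w)) / (w - 0)) has_contour_integral 2 * of_real pi * \<i> * (g 0 / (1 - y * 0)))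
      (circlepath 0 (1 / \<rho>))"
  proof (rule Cauchy_integral_circlepath)
    have sub: "cball 0 (1 / \<rho>) \<subseteq> (ball 0 (1 / R) :: complex set)"
      using R by (simp add: cball_subset_ball_iff frac_less2)
    \<comment> \<open>In the coordinate w the pole at y sits at 1/y, and
      \<open>norm y < \<rho>\<close> places it outside the closed disc of radius 1/\<rho>.\<close>
    have "1 - y * w \<noteq> 0" if "w \<in> cball 0 (1 / \<rho>)" for w
    proof
      assume "1 - y * w = 0"
      hence "norm y * norm w = 1" by (metis eq_iff_diff_eq_0 norm_mult norm_one)
      moreover have "norm y * norm w \<le> norm y * (1 / \<rho>)"
        using that by (intro mult_left_mono) auto
      moreover have "norm y * (1 / \<rho>) < 1" using y R by simp
      ultimately show False by simp
    qed
    hence *: "(\<lambda>w. g w / (1 - y * w)) holomorphic_on cball 0 (1 / \<rho>)"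
      using g sub by (auto intro!: holomorphic_intros intro: holomorphic_on_subset)
    show "continuous_on (cball 0 (1 / \<rho>)) (\<lambda>w. g w / (1 - y * w))"
      using * by (rule holomorphic_on_imp_continuous_on)
    show "(\<lambda>w. g w / (1 - y * w)) holomorphic_on ball 0 (1 / \<rho>)"
      using * by (rule holomorphic_on_subset) auto
  qed (use R in auto)
  hence "contour_integral (circlepath 0 (1 / \<rho>)) (\<lambda>w. (g w / (1 - y * w)) / w) = 0"
    by (simp add: contour_integral_unique g_def)
  also have "contour_integral (circlepath 0 (1 / \<rho>)) (\<lambda>w. (g w / (1 - y * w)) / w) =
      contour_integral (circlepath 0 (1 / \<rho>)) (\<lambda>w. (f (1 / w) - pp (1 / w)) / (1 / w - y) / w\<^sup>2)"
  proof (rule contour_integral_eq)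
    fix w assume "w \<in> path_image (circlepath 0 (1 / \<rho>))"
    hence "w \<noteq> 0" using pi R by auto
    hence "(1 - y * w) * w = (1 / w - y) * w\<^sup>2"
      by (simp add: field_simps power2_eq_square)
    thus "(g w / (1 - y * w)) / w = (f (1 / w) - pp (1 / w)) / (1 / w - y) / w\<^sup>2"
      unfolding divide_divide_eq_left using \<open>w \<noteq> 0\<close> by (simp only: g_def if_False)
  qed
  also have "\<dots> = contour_integral (circlepath 0 \<rho>) (\<lambda>\<zeta>. (f \<zeta> - pp \<zeta>) / (\<zeta> - y))"
    using R by (subst (2) contour_integral_circlepath_reciprocal) auto
  finally have rest: "contour_integral (circlepath 0 \<rho>) (\<lambda>\<zeta>. (f \<zeta> - pp \<zeta>) / (\<zeta> - y)) = 0" .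
  have f: "continuous_on (sphere 0 \<rho>) f"
    using holo R by (auto intro!: holomorphic_on_imp_continuous_on intro: holomorphic_on_subset)
  have "(\<lambda>\<zeta>. (f \<zeta> - pp \<zeta>) / (\<zeta> - y)) contour_integrable_on circlepath 0 \<rho>"
    using R pi y f
    by (intro contour_integrable_continuous_circlepath) (auto intro!: continuous_intros simp: pp_def)
  from has_contour_integral_integral[OF this]
  have "((\<lambda>\<zeta>. (f \<zeta> - pp \<zeta>) / (\<zeta> - y)) has_contour_integral 0) (circlepath 0 \<rho>)"
    by (simp only: rest)
  moreover have "((\<lambda>\<zeta>. pp \<zeta> / (\<zeta> - y)) has_contour_integral 2 * of_real pi * \<i> * pp y) (circlepath 0 \<rho>)"
    by (rule Cauchy_integral_circlepath)
       (use y in \<open>auto intro!: continuous_intros holomorphic_intros simp: pp_def\<close>)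
  ultimately have "((\<lambda>\<zeta>. (f \<zeta> - pp \<zeta>) / (\<zeta> - y) + pp \<zeta> / (\<zeta> - y)) has_contour_integral
      0 + 2 * of_real pi * \<i> * pp y) (circlepath 0 \<rho>)"
    by (rule has_contour_integral_add)
  hence "((\<lambda>\<zeta>. f \<zeta> / (\<zeta> - y)) has_contour_integral 2 * of_real pi * \<i> * pp y) (circlepath 0 \<rho>)"
    by (simp add: diff_divide_distrib)
  thus ?thesis
    by (simp add: contour_integral_unique pp)
qed

text \<open>In 1/p the tail is a power series without constant term; convergence at one finite
  nonzero point makes it continuous at 0.\<close>

lemma laurent_tail_tendsto_0:
  fixes b :: "nat \<Rightarrow> complex"
  assumes "eventually (\<lambda>p. (\<lambda>n. b (Suc n) / p ^ Suc n) sums g p) at_infinity"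
  shows "(g \<longlongrightarrow> 0) at_infinity"
proof -
  define c where "c n = (if n = 0 then 0 else b n)" for n
  have *: "(\<lambda>n. c n * (inverse p) ^ n) sums g p" if "(\<lambda>n. b (Suc n) / p ^ Suc n) sums g p" for p
  proof -
    have "(\<lambda>n. c (Suc n) * (inverse p) ^ Suc n) sums g p"
      using that by (simp only: c_def nat.distinct if_False divide_inverse power_inverse)
    from sums_Suc[OF this] show ?thesis by (simp add: c_def)
  qed
  obtain B where B: "\<And>p. norm p \<ge> B \<Longrightarrow> (\<lambda>n. b (Suc n) / p ^ Suc n) sums g p"
    using assms unfolding eventually_at_infinity by blast
  \<comment> \<open>The maximum with 1 keeps \<open>p0\<close> nonzero, so the radius of convergence
    in 1/p is positive.\<close>
  define p0 where "p0 = complex_of_real (max B 1)"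
  have "p0 \<noteq> 0" by (simp add: p0_def)
  have "norm p0 \<ge> B" by (simp add: p0_def)
  hence "summable (\<lambda>n. c n * (inverse p0) ^ n)"
    by (rule sums_summable[OF *[OF B]])
  hence "isCont (\<lambda>y. \<Sum>n. c n * y ^ n) 0"
    by (rule isCont_powser) (use \<open>p0 \<noteq> 0\<close> in simp)
  hence "((\<lambda>y. \<Sum>n. c n * y ^ n) \<longlongrightarrow> 0) (at 0)"
    by (simp add: isCont_def c_def)
  hence "((\<lambda>p. \<Sum>n. c n * inverse p ^ n) \<longlongrightarrow> 0) at_infinity"
    by (simp add: at_to_infinity filterlim_filtermap)
  moreover have "eventually (\<lambda>p. (\<Sum>n. c n * inverse p ^ n) = g p) at_infinity"
    using assms by eventually_elim (use * sums_unique in metis)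
  ultimately show ?thesis
    by (rule Lim_transform_eventually)
qed

text \<open>The derivatives in p and in u acquire the same factor \<phi>', so every function of z
  inherits the homogeneous equation satisfied by z.\<close>

lemma joint_holomorphic_compose:
  assumes f: "joint_holomorphic_on f G"
    and \<phi>: "\<And>p v. (p, v) \<in> G \<Longrightarrow> (\<phi> has_field_derivative \<phi>' (f p v)) (at (f p v))"
  shows "joint_holomorphic_on (\<lambda>p v. \<phi> (f p v)) G"
    and "\<And>p v. (p, v) \<in> G \<Longrightarrow> deriv (\<lambda>x. \<phi> (f x v)) p = \<phi>' (f p v) * deriv (\<lambda>x. f x v) p"
    and "\<And>p v i. (p, v) \<in> G \<Longrightarrow> partial i (\<lambda>w. \<phi> (f p w)) v = \<phi>' (f p v) * partial i (f p) v"
proof -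
  have *: "((\<lambda>(x, w). \<phi> (f x w)) has_derivative
      (\<lambda>(k, h). \<phi>' (f p v) * deriv (\<lambda>x. f x v) p * k + (\<Sum>i\<in>UNIV. \<phi>' (f p v) * partial i (f p) v * h $ i))) (at (p, v))"
    if "(p, v) \<in> G" for p v
  proof -
    have "((\<lambda>y. \<phi> ((\<lambda>(x, w). f x w) y)) has_derivative (\<lambda>y. \<phi>' (f p v) *
        (\<lambda>(k, h). deriv (\<lambda>x. f x v) p * k + (\<Sum>i\<in>UNIV. partial i (f p) v * h $ i)) y)) (at (p, v))"
      by (rule has_derivative_compose[OF joint_holomorphic_has_derivative[OF f that]])
         (use \<phi>[OF that] in \<open>simp add: has_field_derivative_def\<close>)
    thus ?thesis
      by (simp add: case_prod_unfold sum_distrib_left ring_distribs mult.assoc)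
  qed
  show "joint_holomorphic_on (\<lambda>p v. \<phi> (f p v)) G"
    unfolding joint_holomorphic_on_def
  proof safe
    fix p v assume "(p, v) \<in> G"
    from *[OF this] show "\<exists>c d. ((\<lambda>(x, w). \<phi> (f x w)) has_derivative
        (\<lambda>(k, h). c * k + (\<Sum>i\<in>UNIV. d i * h $ i))) (at (p, v))"
      by (intro exI)
  qed
  show "deriv (\<lambda>x. \<phi> (f x v)) p = \<phi>' (f p v) * deriv (\<lambda>x. f x v) p" if "(p, v) \<in> G" for p v
    by (rule DERIV_imp_deriv[OF joint_derivative_fst[OF *[OF that]]])
  show "partial i (\<lambda>w. \<phi> (f p w)) v = \<phi>' (f p v) * partial i (f p) v" if "(p, v) \<in> G" for p v i
    unfolding partial_eq_deriv_upd[of i "\<lambda>w. \<phi> (f p w)"]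
    by (rule DERIV_imp_deriv[OF vec_derivative_partial[OF joint_derivative_snd[OF *[OF that]]]])
qed

section \<open>The inverse of z, and poles of R_i inside D\<close>

locale whitham_data =
  fixes U :: "(complex^'n) set"
    and r :: "'n \<Rightarrow> 'n \<Rightarrow> complex^'n \<Rightarrow> complex"
    and pole :: "'n \<Rightarrow> complex^'n \<Rightarrow> complex"
    and D D' :: "complex^'n \<Rightarrow> complex set"
    and z :: "complex \<Rightarrow> complex^'n \<Rightarrow> complex"
  assumes open_U: "open U"
    and pole_distinct: "\<And>v. v \<in> U \<Longrightarrow> inj (\<lambda>k. pole k v)"
    and D: "infinity_nbhds U D"
    and D': "infinity_nbhds U D'"
    and z_holo: "joint_holomorphic_on z (total_space U D)"
    and z_univalent: "\<And>v. v \<in> U \<Longrightarrow> bij_betw (\<lambda>p. z p v) (D v) (D' v)"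
    and z_pde: "\<And>i p v. v \<in> U \<Longrightarrow> p \<in> D v \<Longrightarrow> (\<And>k. p \<noteq> pole k v) \<Longrightarrow>
      partial i (z p) v + Rfun r pole i p v * deriv (\<lambda>x. z x v) p = 0"
begin

abbreviation "P \<equiv> inverse_fun D z"

lemma in_total: "v \<in> U \<Longrightarrow> p \<in> X v \<Longrightarrow> (p, v) \<in> total_space U X"
  by (simp add: total_space_def)

lemma open_total: "open (total_space U D)" "open (total_space U D')"
  using D D' by (auto simp: infinity_nbhds_def)

lemma open_D: "v \<in> U \<Longrightarrow> open (D v)"
proof -
  assume "v \<in> U"
  have "open ((\<lambda>x. (x, v)) -` total_space U D)"
    by (rule open_vimage[OF open_total(1)]) (intro continuous_intros)
  thus ?thesis using \<open>v \<in> U\<close> by (simp add: total_space_def vimage_def)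
qed

lemma holomorphic_D:
  assumes "joint_holomorphic_on f (total_space U D)" "v \<in> U"
  shows "(\<lambda>p. f p v) holomorphic_on D v"
  by (rule joint_holomorphic_slice[OF assms(1)]) (use assms(2) in \<open>auto intro: in_total\<close>)

lemma deriv_z_nonzero:
  assumes "v \<in> U" "p \<in> D v"
  shows "deriv (\<lambda>x. z x v) p \<noteq> 0"
  by (rule holomorphic_injective_imp_regular[OF holomorphic_D[OF z_holo assms(1)] open_D])
     (use assms z_univalent in \<open>auto simp: bij_betw_def\<close>)

lemma isCont_deriv_D:
  assumes "joint_holomorphic_on f (total_space U D)" "v \<in> U" "p \<in> D v"
  shows "isCont (deriv (\<lambda>x. f x v)) p"
  using holomorphic_deriv[OF holomorphic_D[OF assms(1,2)] open_D] assms
  by (meson continuous_on_eq_continuous_at holomorphic_on_imp_continuous_on open_D)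

lemma isCont_partial_D:
  assumes "joint_holomorphic_on f (total_space U D)" "v \<in> U" "p \<in> D v"
  shows "isCont (\<lambda>x. partial i (f x) v) p"
proof -
  have "isCont (\<lambda>(x, v). partial i (f x) v) (p, v)"
    using joint_holomorphic_continuous_partial[OF assms(1) open_total(1)] assms(2,3) open_total(1)
      in_total[of v p D]
    by (simp add: continuous_on_eq_continuous_at)
  from isCont_o2[where f = "\<lambda>x. (x, v)" and g = "\<lambda>(x, v). partial i (f x) v" and a = p, OF _ this]
  show ?thesis by simp
qed

lemma eventually_not_pole:
  assumes "v \<in> U" "p \<in> D v"
  shows "eventually (\<lambda>x. x \<in> D v \<and> (\<forall>k. x \<noteq> pole k v)) (at p)"
proof -
  have "eventually (\<lambda>x. \<forall>k\<in>UNIV. x \<noteq> pole k v) (at p)"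
    by (intro eventually_ball_finite ballI eventually_neq_at_within finite_class.finite_UNIV)
  thus ?thesis
    using eventually_at_in_open'[OF open_D[OF assms(1)] assms(2)] by eventually_elim auto
qed

text \<open>A pole of \<open>R\<^sub>i\<close> inside \<open>D v\<close> would contradict the regularity of \<open>z\<close> there, because the
  derivative of a univalent function has no zero.\<close>

lemma residue_zero_in_D:
  assumes v: "v \<in> U" and k: "pole k v \<in> D v"
  shows "r i k v = 0"
proof -
  define p where "p = pole k v"
  have cont: "isCont (\<lambda>x. r i l v / (x - pole l v)) p" if "l \<noteq> k" for l
    using that injD[OF pole_distinct[OF v], of k l] by (auto intro!: continuous_intros simp: p_def)
  \<comment> \<open>This is the equation for z multiplied by x - p, with the denominator of the k-th
    term of R_i cleared. It is continuous at p, where only the residue times the derivative of z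
    remains.\<close>
  have "isCont (\<lambda>x. (x - p) * partial i (z x) v + ((x - p) * (\<Sum>l\<in>UNIV-{k}. r i l v / (x - pole l v)) + r i k v) * deriv (\<lambda>x. z x v) x) p"
    using k by (intro continuous_intros cont isCont_partial_D[OF z_holo v] isCont_deriv_D[OF z_holo v])
               (auto simp: p_def)
  hence "((\<lambda>x. (x - p) * partial i (z x) v + ((x - p) * (\<Sum>l\<in>UNIV-{k}. r i l v / (x - pole l v)) + r i k v) * deriv (\<lambda>x. z x v) x)
      \<longlongrightarrow> r i k v * deriv (\<lambda>x. z x v) p) (at p)"
    by (simp add: isCont_def)
  moreover have "eventually (\<lambda>x. (x - p) * partial i (z x) v + ((x - p) * (\<Sum>l\<in>UNIV-{k}. r i l v / (x - pole l v)) + r i k v) * deriv (\<lambda>x. z x v) x = 0) (at p)"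
    using eventually_not_pole[OF v k, folded p_def]
  proof eventually_elim
    case (elim x)
    hence "x - p \<noteq> 0" by (auto simp: p_def)
    have "Rfun r pole i x v = (\<Sum>l\<in>UNIV-{k}. r i l v / (x - pole l v)) + r i k v / (x - p)"
      unfolding Rfun_def p_def by (subst sum.remove[of UNIV k]) auto
    hence "(x - p) * Rfun r pole i x v = (x - p) * (\<Sum>l\<in>UNIV-{k}. r i l v / (x - pole l v)) + r i k v"
      using \<open>x - p \<noteq> 0\<close> by (simp add: distrib_left)
    moreover have "(x - p) * (partial i (z x) v + Rfun r pole i x v * deriv (\<lambda>x. z x v) x) = 0"
      using z_pde[OF v, of x i] elim by simp
    ultimately show ?case by (simp only: distrib_left mult.assoc[symmetric])
  qed
  hence "((\<lambda>x. (x - p) * partial i (z x) v + ((x - p) * (\<Sum>l\<in>UNIV-{k}. r i l v / (x - pole l v)) + r i k v) * deriv (\<lambda>x. z x v) x) \<longlongrightarrow> 0) (at p)"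
    by (rule tendsto_eventually)
  ultimately have "r i k v * deriv (\<lambda>x. z x v) p = 0"
    by (rule LIM_unique)
  thus ?thesis
    using deriv_z_nonzero[OF v k] by (simp add: p_def)
qed

text \<open>A pole met in D has residue zero, so its summand is the zero function of x and both
  sides are continuous at p. The equation, known off the finitely many poles, therefore passes to
  the limit.\<close>

lemma pde_at_poles:
  assumes f: "joint_holomorphic_on f (total_space U D)" and v: "v \<in> U" and p: "p \<in> D v"
    and pde: "\<And>x. x \<in> D v \<Longrightarrow> (\<And>k. x \<noteq> pole k v) \<Longrightarrow>
      partial i (f x) v + Rfun r pole i x v * deriv (\<lambda>x. f x v) x = (\<Sum>k\<in>UNIV. r i k v * c k / (x - pole k v))"
  shows "partial i (f p) v + Rfun r pole i p v * deriv (\<lambda>x. f x v) p = (\<Sum>k\<in>UNIV. r i k v * c k / (p - pole k v))"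
proof -
  have cont: "isCont (\<lambda>x. r i k v * C / (x - pole k v)) p" for k C
  proof (cases "p = pole k v")
    case True
    hence "r i k v = 0" using residue_zero_in_D[OF v] p by simp
    thus ?thesis by simp
  qed (auto intro!: continuous_intros)
  have "isCont (\<lambda>x. partial i (f x) v + Rfun r pole i x v * deriv (\<lambda>x. f x v) x -
      (\<Sum>k\<in>UNIV. r i k v * c k / (x - pole k v))) p"
    unfolding Rfun_def
    by (intro continuous_intros cont cont[where C = 1, simplified] isCont_partial_D[OF f v p] isCont_deriv_D[OF f v p])
  moreover have "eventually (\<lambda>x. partial i (f x) v + Rfun r pole i x v * deriv (\<lambda>x. f x v) x -
      (\<Sum>k\<in>UNIV. r i k v * c k / (x - pole k v)) = 0) (at p)"
    using eventually_not_pole[OF v p] by eventually_elim (simp add: pde)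
  ultimately have "partial i (f p) v + Rfun r pole i p v * deriv (\<lambda>x. f x v) p -
      (\<Sum>k\<in>UNIV. r i k v * c k / (p - pole k v)) = 0"
    unfolding isCont_def by (rule LIM_unique[OF _ tendsto_eventually])
  thus ?thesis by simp
qed

lemma z_pde_everywhere:
  assumes "v \<in> U" "p \<in> D v"
  shows "partial i (z p) v + Rfun r pole i p v * deriv (\<lambda>x. z x v) p = 0"
  using pde_at_poles[OF z_holo assms, of i "\<lambda>_. 0"] z_pde[OF assms(1)] by simp

lemma P_in_D: "v \<in> U \<Longrightarrow> x \<in> D' v \<Longrightarrow> P x v \<in> D v"
  using the_inv_into_into[of "\<lambda>p. z p v" "D v" x "D v"] z_univalent[of v]
  by (simp add: inverse_fun_def bij_betw_def)

lemma z_P: "v \<in> U \<Longrightarrow> x \<in> D' v \<Longrightarrow> z (P x v) v = x"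
  using f_the_inv_into_f[of "\<lambda>p. z p v" "D v" x] z_univalent[of v]
  by (simp add: inverse_fun_def bij_betw_def)

lemma P_z: "v \<in> U \<Longrightarrow> p \<in> D v \<Longrightarrow> P (z p v) v = p"
  using the_inv_into_f_f[of "\<lambda>p. z p v" "D v" p] z_univalent[of v]
  by (simp add: inverse_fun_def bij_betw_def)

lemma z_in_D': "v \<in> U \<Longrightarrow> p \<in> D v \<Longrightarrow> z p v \<in> D' v"
  using z_univalent[of v] by (auto simp: bij_betw_def)

text \<open>The map \<Phi>: (p, v) to (z, v) has a triangular derivative that can be inverted
  explicitly. Continuity of its inverse \<Psi> comes from invariance of domain, and
  differentiability then follows.\<close>

lemma P_has_derivative:
  assumes v: "v \<in> U" and x: "x \<in> D' v"
  shows "((\<lambda>(x, w). P x w) has_derivative (\<lambda>(k, h). 1 / deriv (\<lambda>x. z x v) (P x v) * k +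
     (\<Sum>i\<in>UNIV. Rfun r pole i (P x v) v * h $ i))) (at (x, v))"
proof -
  define p where "p = P x v"
  define c where "c = deriv (\<lambda>x. z x v) p"
  define d where "d i = partial i (z p) v" for i
  define \<Phi> where "\<Phi> = (\<lambda>y :: complex \<times> (complex^'n). ((\<lambda>(x, w). z x w) y, snd y))"
  define \<Psi> where "\<Psi> = (\<lambda>y :: complex \<times> (complex^'n). ((\<lambda>(x, w). P x w) y, snd y))"
  have p: "p \<in> D v" "z p v = x" using P_in_D z_P v x by (auto simp: p_def)
  have c: "c \<noteq> 0" using deriv_z_nonzero[OF v p(1)] by (simp add: c_def)
  have "continuous_on (\<Phi> ` total_space U D) \<Psi>"
  proof (rule continuous_on_inverse_open)
    show "continuous_on (total_space U D) \<Phi>"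
      unfolding \<Phi>_def
      by (intro continuous_intros joint_holomorphic_continuous[OF z_holo, unfolded case_prod_unfold[abs_def]]
            joint_holomorphic_continuous[OF z_holo])
    show "\<And>y. y \<in> total_space U D \<Longrightarrow> \<Psi> (\<Phi> y) = y"
      by (auto simp: \<Phi>_def \<Psi>_def total_space_def P_z)
  qed (auto simp: open_total)
  moreover have "\<Phi> ` total_space U D = total_space U D'"
  proof (intro equalityI subsetI)
    fix y assume "y \<in> \<Phi> ` total_space U D"
    thus "y \<in> total_space U D'" by (auto simp: \<Phi>_def total_space_def z_in_D')
  next
    fix y assume "y \<in> total_space U D'"
    hence "\<Psi> y \<in> total_space U D" "y = \<Phi> (\<Psi> y)"
      by (auto simp: total_space_def \<Phi>_def \<Psi>_def P_in_D z_P)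
    thus "y \<in> \<Phi> ` total_space U D" by (rule image_eqI[rotated])
  qed
  ultimately have "isCont \<Psi> (x, v)"
    using open_total(2) in_total[of v x D'] v x by (simp add: continuous_on_eq_continuous_at)
  have d\<Phi>: "(\<Phi> has_derivative (\<lambda>y. ((\<lambda>(k, h). c * k + (\<Sum>i\<in>UNIV. d i * h $ i)) y, snd y))) (at (\<Psi> (x, v)))"
  proof -
    have "(p, v) \<in> total_space U D" using v p(1) by (rule in_total)
    from has_derivative_Pair[OF joint_holomorphic_has_derivative[OF z_holo this]
        has_derivative_snd[OF has_derivative_ident]]
    show ?thesis by (simp only: \<Phi>_def \<Psi>_def c_def d_def p_def case_prod_conv snd_conv)
  qed
  have "(\<Sum>i\<in>UNIV. d i * (s *\<^sub>R h) $ i) = s *\<^sub>R (\<Sum>i\<in>UNIV. d i * h $ i)" for s and h :: "complex^'n"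
    by (simp add: scaleR_sum_right)
  hence "linear (\<lambda>y :: complex \<times> (complex^'n). ((fst y - (\<Sum>i\<in>UNIV. d i * snd y $ i)) / c, snd y))"
    by (intro linearI)
       (simp_all add: distrib_left sum.distrib add_divide_distrib diff_divide_distrib scaleR_diff_right
          scaleR_conv_of_real[where 'a = complex] right_diff_distrib)
  hence bl: "bounded_linear (\<lambda>y :: complex \<times> (complex^'n). ((fst y - (\<Sum>i\<in>UNIV. d i * snd y $ i)) / c, snd y))"
    by (simp add: linear_conv_bounded_linear)
  have "(\<Psi> has_derivative (\<lambda>y. ((fst y - (\<Sum>i\<in>UNIV. d i * snd y $ i)) / c, snd y))) (at (x, v))"
  proof (rule has_derivative_inverse_basic[OF d\<Phi> bl _ \<open>isCont \<Psi> (x, v)\<close> open_total(2)])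
    show "(\<lambda>y. ((fst y - (\<Sum>i\<in>UNIV. d i * snd y $ i)) / c, snd y)) \<circ>
        (\<lambda>y. ((\<lambda>(k, h). c * k + (\<Sum>i\<in>UNIV. d i * h $ i)) y, snd y)) = id"
      using c by (auto simp: fun_eq_iff)
    show "\<And>y. y \<in> total_space U D' \<Longrightarrow> \<Phi> (\<Psi> y) = y"
      by (auto simp: \<Phi>_def \<Psi>_def total_space_def z_P)
    show "(x, v) \<in> total_space U D'" using v x by (rule in_total)
  qed
  from has_derivative_fst[OF this]
  have "((\<lambda>(x, w). P x w) has_derivative (\<lambda>y. (fst y - (\<Sum>i\<in>UNIV. d i * snd y $ i)) / c)) (at (x, v))"
    by (simp add: \<Psi>_def)
  also have "(\<lambda>y. (fst y - (\<Sum>i\<in>UNIV. d i * snd y $ i)) / c) =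
      (\<lambda>(k, h). 1 / c * k + (\<Sum>i\<in>UNIV. Rfun r pole i p v * h $ i))"
  proof -
    \<comment> \<open>Division of the equation for z by its nonzero p-derivative gives the inverse
      form \<partial>p/\<partial>u_i = R_i.\<close>
    have "Rfun r pole i p v = - d i / c" for i
      using z_pde_everywhere[OF v p(1), of i] c
      by (simp add: d_def[symmetric] c_def[symmetric] field_simps eq_neg_iff_add_eq_0)
    thus ?thesis
      by (simp add: fun_eq_iff diff_divide_distrib sum_divide_distrib sum_negf)
  qed
  finally show ?thesis by (simp only: c_def p_def)
qed

lemma P_holo: "joint_holomorphic_on P (total_space U D')"
  unfolding joint_holomorphic_on_def
proof safe
  fix x v assume "(x, v) \<in> total_space U D'"
  hence "v \<in> U" "x \<in> D' v" by (auto simp: total_space_def)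
  from P_has_derivative[OF this]
  show "\<exists>c d. ((\<lambda>(x, w). P x w) has_derivative (\<lambda>(k, h). c * k + (\<Sum>i\<in>UNIV. d i * h $ i))) (at (x, v))"
    by (intro exI)
qed

lemma P_partial:
  assumes "v \<in> U" "x \<in> D' v"
  shows "partial i (P x) v = Rfun r pole i (P x v) v"
  unfolding partial_eq_deriv_upd[of i "P x"]
  by (rule DERIV_imp_deriv[OF vec_derivative_partial[OF joint_derivative_snd[OF P_has_derivative[OF assms]]]])

lemma isCont_P:
  assumes "v \<in> U" "x \<in> D' v"
  shows "isCont (P x) v"
  by (rule has_derivative_continuous[OF joint_derivative_snd[OF P_has_derivative[OF assms]]])

section \<open>The transport identity for each \<Omega>_A\<close>

text \<open>A small circle around the puncture at v, with p and all poles outside, serves for all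
  nearby parameters: by the tube lemma its disc stays in D, and by continuity of \<open>P x0\<close>
  the moving puncture stays inside.\<close>

lemma singular_part_transport:
  fixes n :: nat
  assumes x0: "\<And>w. w \<in> U \<Longrightarrow> x0 \<in> D' w" and v: "v \<in> U" and p: "p \<in> D v" "p \<noteq> P x0 v"
    and pole: "\<And>k. pole k v \<noteq> P x0 v"
  defines "\<Omega> \<equiv> \<lambda>y w. singular_part (\<lambda>x. (1 / (z x w - x0)) ^ n) (P x0 w) y"
  shows "partial i (\<Omega> p) v + Rfun r pole i p v * deriv (\<lambda>x. \<Omega> x v) p =
         (\<Sum>k\<in>UNIV. r i k v / (p - pole k v) * deriv (\<lambda>x. \<Omega> x v) (pole k v))"
proof -
  define Z where "Z = (\<lambda>x w. (1 / (z x w - x0)) ^ n)"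
  define c where "c = P x0 v"
  have c: "c \<in> D v" unfolding c_def by (rule P_in_D[OF v x0[OF v]])
  have "open (D v - insert p (range (\<lambda>k. pole k v)))"
    by (intro open_Diff open_D v finite_imp_closed) auto
  moreover have "c \<in> D v - insert p (range (\<lambda>k. pole k v))"
    using c p(2) pole by (auto simp: c_def[symmetric])
  ultimately obtain \<rho> where \<rho>: "\<rho> > 0" "cball c \<rho> \<subseteq> D v - insert p (range (\<lambda>k. pole k v))"
    using open_contains_cball by blast
  \<comment> \<open>By univalence the puncture is the only zero of z - x0 in D, hence the only
    singularity of Z.\<close>
  have zx: "z x w = x0 \<longleftrightarrow> x = P x0 w" if "w \<in> U" "x \<in> D w" for x w
    using P_z[OF that] z_P[OF that(1) x0[OF that(1)]] by auto
  have nearU: "eventually (\<lambda>w. w \<in> U) (nhds v)"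
    by (rule eventually_nhds_in_open[OF open_U v])
  have opn: "open ((\<lambda>y. (snd y, fst y)) -` total_space U D)"
    by (rule open_vimage[OF open_total(1)]) (intro continuous_intros)
  have "{v} \<times> cball c \<rho> \<subseteq> (\<lambda>y. (snd y, fst y)) -` total_space U D"
    using \<rho> v by (auto simp: total_space_def)
  from Elementary_Topology.tube_lemma[OF compact_cball opn this]
  obtain X where X: "v \<in> X" "open X" "X \<times> cball c \<rho> \<subseteq> (\<lambda>y. (snd y, fst y)) -` total_space U D"
    by blast
  have nearX: "eventually (\<lambda>w. w \<in> X) (nhds v)"
    by (rule eventually_nhds_in_open[OF X(2,1)])
  have "filterlim (P x0) (nhds c) (nhds v)"
    using isCont_P[OF v x0[OF v]] tendsto_at_iff_tendsto_nhds[of "P x0" v] by (simp add: isCont_def c_def)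
  hence nearq: "eventually (\<lambda>w. P x0 w \<in> ball c \<rho>) (nhds v)"
    by (rule eventually_compose_filterlim[OF eventually_nhds_in_open[OF open_ball], rotated])
       (use \<rho> in simp)
  \<comment> \<open>Removing the zeros of z - x0 leaves an open set on which Z is jointly
    holomorphic and which still contains the circle over v.\<close>
  define G where "G = {y \<in> total_space U D. (\<lambda>(x, w). z x w) y \<noteq> x0}"
  have "open (total_space U D \<inter> (\<lambda>(x, w). z x w) -` (- {x0}))"
    by (rule continuous_open_preimage[OF joint_holomorphic_continuous[OF z_holo] open_total(1)]) auto
  also have "total_space U D \<inter> (\<lambda>(x, w). z x w) -` (- {x0}) = G"
    by (auto simp: G_def)
  finally have "open G" .
  have zG: "joint_holomorphic_on z G"
    by (rule joint_holomorphic_subset[OF z_holo]) (auto simp: G_def)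
  define \<phi>' where "\<phi>' = (\<lambda>s. of_nat n * (1 / (s - x0)) ^ (n - 1) * (- (1 / (s - x0)\<^sup>2)))"
  have \<phi>: "((\<lambda>s. (1 / (s - x0)) ^ n) has_field_derivative \<phi>' (z x w)) (at (z x w))" if "(x, w) \<in> G" for x w
    using that unfolding \<phi>'_def G_def by (auto intro!: derivative_eq_intros simp: power2_eq_square)
  note Z = joint_holomorphic_compose[OF zG \<phi>, folded Z_def]
  have sphere: "(\<zeta>, v) \<in> G" if "\<zeta> \<in> sphere c \<rho>" for \<zeta>
  proof -
    have "\<zeta> \<in> D v" "\<zeta> \<noteq> c" using that \<rho> by auto
    thus ?thesis using v zx[of v \<zeta>] by (simp add: G_def total_space_def c_def)
  qed
  have rep: "eventually (\<lambda>w. \<forall>y\<in>- cball c \<rho>. \<Omega> y w =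
      - (1 / (2 * pi * \<i>)) * contour_integral (circlepath c \<rho>) (\<lambda>\<zeta>. Z \<zeta> w / (\<zeta> - y))) (nhds v)"
    using nearU nearX nearq
  proof eventually_elim
    case (elim w)
    have sub: "cball c \<rho> \<subseteq> D w"
    proof
      fix x assume "x \<in> cball c \<rho>"
      hence "(w, x) \<in> X \<times> cball c \<rho>" using elim by blast
      from subsetD[OF X(3) this] show "x \<in> D w" by (simp add: total_space_def)
    qed
    have z: "(\<lambda>x. z x w) holomorphic_on D w"
      by (rule holomorphic_D[OF z_holo elim(1)])
    have q: "P x0 w \<in> D w" by (rule P_in_D[OF elim(1) x0[OF elim(1)]])
    have holo: "(\<lambda>x. Z x w) holomorphic_on D w - {P x0 w}"
      unfolding Z_def using zx[OF elim(1)]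
      by (intro holomorphic_intros holomorphic_on_subset[OF z]) auto
    have "(\<lambda>x. (z x w - x0) ^ n) holomorphic_on D w"
      by (intro holomorphic_intros z)
    hence an: "(\<lambda>x. (z x w - x0) ^ n) analytic_on {P x0 w}"
      using open_D[OF elim(1)] q by (rule holomorphic_on_imp_analytic_at)
    have "not_essential (\<lambda>x. inverse ((z x w - x0) ^ n)) (P x0 w)"
      by (intro not_essential_inverse not_essential_analytic isolated_singularity_at_analytic an)
    hence ness: "not_essential (\<lambda>x. Z x w) (P x0 w)"
      by (simp add: Z_def field_simps)
    show ?case
    proof
      fix y assume "y \<in> - cball c \<rho>"
      hence "y \<notin> cball c \<rho>" by simp
      from contour_integral_singular_part[OF open_D[OF elim(1)] sub elim(3) this holo ness]
      show "\<Omega> y w = - (1 / (2 * pi * \<i>)) * contour_integral (circlepath c \<rho>) (\<lambda>\<zeta>. Z \<zeta> w / (\<zeta> - y))"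
        by (simp add: \<Omega>_def Z_def)
    qed
  qed
  show ?thesis
    unfolding Rfun_def
  proof (rule Cauchy_part_transport[OF Z(1) \<open>open G\<close> sphere _ _ _ _ _ _ rep])
    fix \<zeta> assume \<zeta>: "\<zeta> \<in> sphere c \<rho>"
    hence "\<zeta> \<in> D v" using \<rho> by auto
    have "partial i (Z \<zeta>) v + (\<Sum>k\<in>UNIV. r i k v / (\<zeta> - pole k v)) * deriv (\<lambda>x. Z x v) \<zeta> =
        \<phi>' (z \<zeta> v) * (partial i (z \<zeta>) v + Rfun r pole i \<zeta> v * deriv (\<lambda>x. z x v) \<zeta>)"
      using Z(2)[OF _ sphere[OF \<zeta>]] Z(3)[OF _ sphere[OF \<zeta>], of i]
      by (simp add: Z_def Rfun_def algebra_simps)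
    thus "partial i (Z \<zeta>) v + (\<Sum>k\<in>UNIV. r i k v / (\<zeta> - pole k v)) * deriv (\<lambda>x. Z x v) \<zeta> = 0"
      by (simp add: z_pde_everywhere[OF v \<open>\<zeta> \<in> D v\<close>])
  next
    show "pole k v \<in> - cball c \<rho>" "p \<in> - cball c \<rho>" for k
      using \<rho> by auto
    show "r i k v = 0" if "pole k v = p" for k
      using residue_zero_in_D[OF v] that p by simp
  qed (use \<rho> in auto)
qed

text \<open>Beyond a fixed radius z is defined for all parameters near v, so one large circle around
  0 serves for all of them. It encloses p and every pole, including any pole outside D.\<close>

lemma polynomial_part_transport:
  fixes n :: nat
  assumes laurent: "\<And>w. w \<in> U \<Longrightarrow> ((\<lambda>x. z x w - x) \<longlongrightarrow> 0) at_infinity"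
    and n: "n > 0" and v: "v \<in> U" and p: "p \<in> D v"
  defines "\<Omega> \<equiv> \<lambda>y w. polynomial_part (\<lambda>x. z x w ^ n) y"
  shows "partial i (\<Omega> p) v + Rfun r pole i p v * deriv (\<lambda>x. \<Omega> x v) p =
         (\<Sum>k\<in>UNIV. r i k v / (p - pole k v) * deriv (\<lambda>x. \<Omega> x v) (pole k v))"
proof -
  define Z where "Z = (\<lambda>x w. z x w ^ n)"
  obtain R0 where R0: "eventually (\<lambda>w. \<forall>p. norm p > R0 \<longrightarrow> p \<in> D w) (nhds v)"
    using D v unfolding infinity_nbhds_def by blast
  define R where "R = max R0 1"
  \<comment> \<open>The added 1 makes all inequalities strict: p and the poles lie inside the
    circle, and the circle lies where z is defined.\<close>
  define \<rho> where "\<rho> = 1 + Max (insert R (insert (norm p) (range (\<lambda>k. norm (pole k v)))))"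
  have "x < \<rho>" if "x \<in> insert R (insert (norm p) (range (\<lambda>k. norm (pole k v))))" for x
    unfolding \<rho>_def using Max_ge[OF _ that] by simp
  hence \<rho>: "R < \<rho>" "norm p < \<rho>" "norm (pole k v) < \<rho>" for k
    by blast+
  have R: "R > 0" "R \<ge> R0" by (auto simp: R_def)
  have DR: "x \<in> D v" if "norm x > R" for x
    using eventually_nhds_x_imp_x[OF R0] that R by auto
  define \<phi>' where "\<phi>' = (\<lambda>s :: complex. of_nat n * s ^ (n - 1))"
  have \<phi>: "((\<lambda>s. s ^ n) has_field_derivative \<phi>' (z x w)) (at (z x w))" for x w
    unfolding \<phi>'_def by (auto intro!: derivative_eq_intros)
  note Z = joint_holomorphic_compose[OF z_holo \<phi>, folded Z_def]
  have sphere: "(\<zeta>, v) \<in> total_space U D" "\<zeta> \<in> D v" if "\<zeta> \<in> sphere 0 \<rho>" for \<zeta> :: complex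
    using that DR[of \<zeta>] v \<rho> by (auto simp: total_space_def)
  have rep: "eventually (\<lambda>w. \<forall>y\<in>ball 0 \<rho>. \<Omega> y w =
      1 / (2 * pi * \<i>) * contour_integral (circlepath 0 \<rho>) (\<lambda>\<zeta>. Z \<zeta> w / (\<zeta> - y))) (nhds v)"
    using R0 eventually_nhds_in_open[OF open_U v]
  proof eventually_elim
    case (elim w)
    have holo: "(\<lambda>x. Z x w) holomorphic_on {x. norm x > R}"
      unfolding Z_def using elim R
      by (intro holomorphic_intros holomorphic_on_subset[OF holomorphic_D[OF z_holo elim(2)]]) auto
    \<comment> \<open>Since z - x tends to 0, a positive power of z has a pole at infinity, which
      rules out an essential singularity there.\<close>
    have "filterlim (\<lambda>x. (z x w - x) + x) at_infinity at_infinity"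
      by (rule tendsto_add_filterlim_at_infinity[OF laurent[OF elim(2)]]) (rule filterlim_ident)
    hence "filterlim (\<lambda>x. z x w ^ n) at_infinity at_infinity"
      using n by (intro Limits.filterlim_power_at_infinity) simp_all
    hence "filterlim (\<lambda>x. Z (1 / x) w) at_infinity (at 0)"
      unfolding Z_def at_to_infinity filterlim_filtermap by (simp add: inverse_eq_divide)
    hence ness: "not_essential (\<lambda>x. Z (1 / x) w) 0"
      by (simp add: not_essential_def is_pole_def)
    show ?case
    proof
      fix y :: complex assume "y \<in> ball 0 \<rho>"
      hence "norm y < \<rho>" by simp
      from contour_integral_polynomial_part[OF R(1) \<rho>(1) this holo ness]
      show "\<Omega> y w = 1 / (2 * pi * \<i>) * contour_integral (circlepath 0 \<rho>) (\<lambda>\<zeta>. Z \<zeta> w / (\<zeta> - y))"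
        by (simp add: \<Omega>_def Z_def)
    qed
  qed
  show ?thesis
    unfolding Rfun_def
  proof (rule Cauchy_part_transport[OF Z(1) open_total(1) sphere(1) _ _ _ _ _ _ rep])
    fix \<zeta> :: complex assume \<zeta>: "\<zeta> \<in> sphere 0 \<rho>"
    have "partial i (Z \<zeta>) v + (\<Sum>k\<in>UNIV. r i k v / (\<zeta> - pole k v)) * deriv (\<lambda>x. Z x v) \<zeta> =
        \<phi>' (z \<zeta> v) * (partial i (z \<zeta>) v + Rfun r pole i \<zeta> v * deriv (\<lambda>x. z x v) \<zeta>)"
      using Z(2)[OF sphere(1)[OF \<zeta>]] Z(3)[OF sphere(1)[OF \<zeta>], of i]
      by (simp add: Z_def Rfun_def algebra_simps)
    thus "partial i (Z \<zeta>) v + (\<Sum>k\<in>UNIV. r i k v / (\<zeta> - pole k v)) * deriv (\<lambda>x. Z x v) \<zeta> = 0"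
      by (simp add: z_pde_everywhere[OF v sphere(2)[OF \<zeta>]])
  next
    show "pole k v \<in> ball 0 \<rho>" "p \<in> ball 0 \<rho>" for k
      using \<rho> by auto
    show "r i k v = 0" if "pole k v = p" for k
      using residue_zero_in_D[OF v] that p by simp
  qed (use \<rho> R in auto)
qed

text \<open>A branch of the logarithm is known only through its exponential, so both of its
  derivatives are read off from exp l = p - q. As q is a value of \<open>P\<close>, its
  u_i-derivative is R_i(q), and an identity of partial fractions remains.\<close>

lemma log_transport:
  assumes W: "open W" and l: "joint_holomorphic_on l W"
    and exp_l: "\<And>x w. (x, w) \<in> W \<Longrightarrow> exp (l x w) = x - P x0 w"
    and v: "v \<in> U" and x0: "x0 \<in> D' v" and p: "p \<in> D v" "(p, v) \<in> W"
    and pole: "\<And>k. (pole k v, v) \<in> W" "\<And>k. pole k v \<noteq> P x0 v"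
  shows "partial i (\<lambda>w. - l p w) v + Rfun r pole i p v * deriv (\<lambda>x. - l x v) p =
         (\<Sum>k\<in>UNIV. r i k v / (p - pole k v) * deriv (\<lambda>x. - l x v) (pole k v))"
proof -
  define q where "q = P x0 v"
  note e = joint_holomorphic_compose[OF l, of exp exp, OF DERIV_exp]
  note m = joint_holomorphic_compose[OF l, of uminus "\<lambda>_. - 1"]
  have ne: "x \<noteq> q" if "(x, v) \<in> W" for x
    using exp_l[OF that] exp_not_eq_zero[of "l x v"] by (auto simp: q_def)
  have dl: "deriv (\<lambda>x. - l x v) x = - (1 / (x - q))" if x: "(x, v) \<in> W" for x
  proof -
    have "open ((\<lambda>x. (x, v)) -` W)"
      by (rule open_vimage[OF W]) (intro continuous_intros)
    hence "eventually (\<lambda>x. x \<in> (\<lambda>x. (x, v)) -` W) (nhds x)"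
      by (rule eventually_nhds_in_open) (use x in simp)
    hence "eventually (\<lambda>x. exp (l x v) = x - q) (nhds x)"
      by eventually_elim (use exp_l in \<open>simp add: q_def\<close>)
    hence "deriv (\<lambda>x. exp (l x v)) x = deriv (\<lambda>x. x - q) x"
      by (rule deriv_cong_ev) simp
    also have "\<dots> = 1"
      by (rule DERIV_imp_deriv) (auto intro!: derivative_eq_intros)
    finally have "(x - q) * deriv (\<lambda>x. l x v) x = 1"
      using e(2)[OF x] exp_l[OF x] by (simp add: q_def)
    hence "deriv (\<lambda>x. l x v) x = 1 / (x - q)"
      using ne[OF x] by (simp add: field_simps)
    moreover have "deriv (\<lambda>x. - l x v) x = - deriv (\<lambda>x. l x v) x"
      using m(2)[OF _ x] by (simp add: DERIV_minus[OF DERIV_ident])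
    ultimately show ?thesis by simp
  qed
  have pl: "partial i (\<lambda>w. - l p w) v = Rfun r pole i q v / (p - q)"
  proof -
    have "open ((\<lambda>s. (p, upd i v s)) -` W)"
      by (rule open_vimage[OF W]) (intro continuous_intros continuous_upd)
    hence "eventually (\<lambda>s. s \<in> (\<lambda>s. (p, upd i v s)) -` W) (nhds (v $ i))"
      by (rule eventually_nhds_in_open) (use p in simp)
    hence "eventually (\<lambda>s. exp (l p (upd i v s)) = p - P x0 (upd i v s)) (nhds (v $ i))"
      by eventually_elim (use exp_l in simp)
    hence "partial i (\<lambda>w. exp (l p w)) v = deriv (\<lambda>s. p - P x0 (upd i v s)) (v $ i)"
      unfolding partial_eq_deriv_upd by (rule deriv_cong_ev) simp
    also have "\<dots> = 0 - partial i (P x0) v"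
      by (intro DERIV_imp_deriv DERIV_diff DERIV_const joint_holomorphic_partial[OF P_holo] in_total v x0)
    also have "partial i (P x0) v = Rfun r pole i q v"
      unfolding q_def by (rule P_partial[OF v x0])
    finally have "(p - q) * partial i (l p) v = - Rfun r pole i q v"
      using e(3)[OF p(2), of i] exp_l[OF p(2)] by (simp add: q_def)
    hence "partial i (l p) v = - Rfun r pole i q v / (p - q)"
      using ne[OF p(2)] by (simp add: field_simps)
    moreover have "partial i (\<lambda>w. - l p w) v = - partial i (l p) v"
      using m(3)[OF _ p(2), of i] by (simp add: DERIV_minus[OF DERIV_ident])
    ultimately show ?thesis by simp
  qed
  \<comment> \<open>Each term of R_i(q) - R_i(p) contains the factor p - q; a pole equal to p has
    residue zero.\<close>
  have "r i k v / (q - pole k v) / (p - q) - r i k v / (p - pole k v) * (1 / (p - q)) =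
      r i k v / (p - pole k v) * - (1 / (pole k v - q))" for k
  proof (cases "p = pole k v")
    case True
    thus ?thesis using residue_zero_in_D[OF v] p by simp
  next
    case False
    hence "p - pole k v \<noteq> 0" "p - q \<noteq> 0" "q - pole k v \<noteq> 0" "pole k v - q \<noteq> 0"
      using ne[OF p(2)] pole(2)[of k] by (auto simp: q_def)
    thus ?thesis by (simp add: divide_simps) (simp add: algebra_simps)
  qed
  thus ?thesis
    unfolding pl dl[OF p(2)] dl[OF pole(1)]
    by (simp add: Rfun_def sum_divide_distrib sum_subtractf[symmetric])
qed

end

section \<open>Dependence on a single time\<close>

text \<open>The two families of times differ at one index, so the change is a finitely supported
  summand: convergence for t carries over to \<open>t(A := s)\<close>, and the dependence on s is
  affine.\<close>

lemma time_sum_upd: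
  assumes sum: "(\<lambda>A. t A * Om A p v) summable_on I" and A: "A \<in> I"
  shows "time_sum I Om p v (t(A := s)) = time_sum I Om p v t + (s - t A) * Om A p v"
proof -
  have "((\<lambda>B. t B * Om B p v) has_sum time_sum I Om p v t) I"
    using sum by (simp add: time_sum_def)
  moreover have "((\<lambda>B. if B = A then (s - t A) * Om A p v else 0) has_sum (s - t A) * Om A p v) I"
    by (rule has_sum_finite_neutralI[of "{A}"]) (use A in auto)
  ultimately have "((\<lambda>B. t B * Om B p v + (if B = A then (s - t A) * Om A p v else 0)) has_sum
      time_sum I Om p v t + (s - t A) * Om A p v) I"
    by (rule has_sum_add)
  also have "(\<lambda>B. t B * Om B p v + (if B = A then (s - t A) * Om A p v else 0)) =
      (\<lambda>B. (t(A := s)) B * Om B p v)"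
    by (auto simp: fun_eq_iff algebra_simps)
  finally show ?thesis
    unfolding time_sum_def by (rule infsumI)
qed

text \<open>Varying a single time shows that each \<open>\<Omega>\<^sub>A\<close> is a difference quotient of the holomorphic time sums.\<close>

lemma termwise_differentiable_summand:
  assumes t: "termwise_differentiable I Om W t" and s: "termwise_differentiable I Om W (t(A := s))"
    and "s \<noteq> t A" "A \<in> I" "open W"
  shows "joint_holomorphic_on (Om A) W"
  unfolding joint_holomorphic_on_def
proof safe
  fix p v assume pv: "(p, v) \<in> W"
  define e where "e = 1 / (s - t A)"
  have sum: "(\<lambda>A. t A * Om A x w) summable_on I" if "(x, w) \<in> W" for x w
    using t that unfolding termwise_differentiable_def by auto
  have eq: "Om A x w = e * (time_sum I Om x w (t(A := s)) - time_sum I Om x w t)" if "(x, w) \<in> W" for x w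
    using time_sum_upd[of t Om x w I A s, OF sum[OF that] \<open>A \<in> I\<close>] \<open>s \<noteq> t A\<close> by (simp add: e_def)
  define f where "f t = (\<lambda>x w. time_sum I Om x w t)" for t
  have hol: "joint_holomorphic_on (f t) W" "joint_holomorphic_on (f (t(A := s))) W"
    using t s by (auto simp: termwise_differentiable_def f_def)
  have "((\<lambda>y. e * ((\<lambda>(x, w). f (t(A := s)) x w) y - (\<lambda>(x, w). f t x w) y)) has_derivative
      (\<lambda>y. e * ((\<lambda>(k, h). deriv (\<lambda>x. f (t(A := s)) x v) p * k + (\<Sum>i\<in>UNIV. partial i (f (t(A := s)) p) v * h $ i)) y -
        (\<lambda>(k, h). deriv (\<lambda>x. f t x v) p * k + (\<Sum>i\<in>UNIV. partial i (f t p) v * h $ i)) y))) (at (p, v))"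
    by (intro has_derivative_mult_right has_derivative_diff joint_holomorphic_has_derivative[OF _ pv] hol)
  hence "((\<lambda>(x, w). Om A x w) has_derivative
      (\<lambda>y. e * ((\<lambda>(k, h). deriv (\<lambda>x. f (t(A := s)) x v) p * k + (\<Sum>i\<in>UNIV. partial i (f (t(A := s)) p) v * h $ i)) y -
        (\<lambda>(k, h). deriv (\<lambda>x. f t x v) p * k + (\<Sum>i\<in>UNIV. partial i (f t p) v * h $ i)) y))) (at (p, v))"
    by (rule has_derivative_transform_within_open[OF _ \<open>open W\<close> pv]) (auto simp: f_def eq)
  also have "(\<lambda>y. e * ((\<lambda>(k, h). deriv (\<lambda>x. f (t(A := s)) x v) p * k + (\<Sum>i\<in>UNIV. partial i (f (t(A := s)) p) v * h $ i)) y -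
        (\<lambda>(k, h). deriv (\<lambda>x. f t x v) p * k + (\<Sum>i\<in>UNIV. partial i (f t p) v * h $ i)) y)) =
      (\<lambda>(k, h). e * (deriv (\<lambda>x. f (t(A := s)) x v) p - deriv (\<lambda>x. f t x v) p) * k +
        (\<Sum>i\<in>UNIV. e * (partial i (f (t(A := s)) p) v - partial i (f t p) v) * h $ i))"
    by (simp add: fun_eq_iff algebra_simps sum_subtractf sum_distrib_left)
  finally show "\<exists>c d. ((\<lambda>(x, w). Om A x w) has_derivative
      (\<lambda>(k, h). c * k + (\<Sum>i\<in>UNIV. d i * h $ i))) (at (p, v))"
    by (intro exI)
qed

lemma has_sum_finite_sum:
  fixes f :: "'a \<Rightarrow> 'b \<Rightarrow> 'c :: topological_comm_monoid_add"
  assumes "\<And>k. k \<in> K \<Longrightarrow> (f k has_sum s k) I"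
  shows "((\<lambda>x. \<Sum>k\<in>K. f k x) has_sum (\<Sum>k\<in>K. s k)) I"
  using assms by (induction K rule: infinite_finite_induct) (simp_all add: has_sum_add)

lemma vec_has_derivative:
  fixes \<gamma> :: "complex \<Rightarrow> complex^'n"
  assumes "\<And>i. ((\<lambda>s. \<gamma> s $ i) has_field_derivative \<gamma>' i) (at s)"
  shows "(\<gamma> has_derivative (\<lambda>k. \<chi> i. \<gamma>' i * k)) (at s)"
proof -
  have "((\<lambda>s. \<Sum>i\<in>UNIV. axis i (\<gamma> s $ i)) has_derivative (\<lambda>k. \<Sum>i\<in>UNIV. axis i (\<gamma>' i * k))) (at s)"
    by (intro has_derivative_sum bounded_linear.has_derivative[OF bounded_linear_axis])
       (use assms in \<open>simp add: has_field_derivative_def\<close>)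
  moreover have "(\<Sum>i\<in>UNIV. axis i (x i)) = (\<chi> i. x i)" for x :: "'n \<Rightarrow> complex"
    by (simp add: vec_eq_iff axis_def if_distrib[of "\<lambda>f. f _"] eq_commute)
  ultimately show ?thesis by simp
qed

text \<open>Caratheodory's form of the derivative. Applied to (s - t_A) times \<Omega>_A at the
  moving point, it asks only for continuity of \<Omega>_A along the path.\<close>

lemma has_field_derivative_mult_continuous:
  fixes g :: "complex \<Rightarrow> complex"
  assumes "isCont g a"
  shows "((\<lambda>s. (s - a) * g s) has_field_derivative g a) (at a)"
  unfolding CARAT_DERIV using assms by (intro exI[of _ g]) (simp add: mult.commute)

section \<open>The time derivative of S along the hodograph solution\<close>

theorem proposition2:
  fixes M :: nat
    and U :: "(complex^'n) set"
    and r :: "'n \<Rightarrow> 'n \<Rightarrow> complex^'n \<Rightarrow> complex"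
    and pole :: "'n \<Rightarrow> complex^'n \<Rightarrow> complex"
    and R :: "'n \<Rightarrow> complex \<Rightarrow> complex^'n \<Rightarrow> complex"
    and D D' :: "complex^'n \<Rightarrow> complex set"
    and z P :: "complex \<Rightarrow> complex^'n \<Rightarrow> complex"
    and a :: "nat \<Rightarrow> complex^'n \<Rightarrow> complex"
    and z0 :: "nat \<Rightarrow> complex"
    and q :: "nat \<Rightarrow> complex^'n \<Rightarrow> complex"
    and W :: "(complex \<times> (complex^'n)) set"
    and lnq :: "nat \<Rightarrow> complex \<Rightarrow> complex^'n \<Rightarrow> complex"
    and Om :: "nat \<times> nat \<Rightarrow> complex \<Rightarrow> complex^'n \<Rightarrow> complex"
    and Sminus :: "complex \<Rightarrow> complex^'n \<Rightarrow> complex"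
    and Stot :: "complex \<Rightarrow> complex^'n \<Rightarrow> (nat \<times> nat \<Rightarrow> complex) \<Rightarrow> complex"
    and F :: "'n \<Rightarrow> complex^'n \<Rightarrow> complex"
    and T :: "(nat \<times> nat \<Rightarrow> complex) set"
    and u :: "(nat \<times> nat \<Rightarrow> complex) \<Rightarrow> complex^'n"
  assumes M: "M \<ge> 1"
    and U: "open U"
    \<comment> \<open>the functions \<open>R\<^sub>i\<close>\<close>
    and r_holo: "\<And>i j. vec_holomorphic_on (r i j) U"
    and pole_holo: "\<And>k. vec_holomorphic_on (pole k) U"
    and pole_distinct: "\<And>v. v \<in> U \<Longrightarrow> inj (\<lambda>k. pole k v)"
    and R: "R = Rfun r pole"
    and compat_pole: "\<And>i j k v. v \<in> U \<Longrightarrow> i \<noteq> j \<Longrightarrow>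
      r i k v * partial j (pole k) v - r j k v * partial i (pole k) v =
      (\<Sum>l\<in>UNIV - {k}. (r j l v * r i k v - r i l v * r j k v) / (pole k v - pole l v))"
    and compat_r: "\<And>i j k v. v \<in> U \<Longrightarrow> i \<noteq> j \<Longrightarrow>
      partial j (r i k) v - partial i (r j k) v =
      2 * (\<Sum>l\<in>UNIV - {k}. (r j k v * r i l v - r i k v * r j l v) / (pole k v - pole l v)\<^sup>2)"
    \<comment> \<open>the function \<open>z\<close> and its inverse \<open>P\<close>\<close>
    and D: "infinity_nbhds U D"
    and D': "infinity_nbhds U D'"
    and z_holo: "joint_holomorphic_on z (total_space U D)"
    and z_univalent: "\<And>v. v \<in> U \<Longrightarrow> bij_betw (\<lambda>p. z p v) (D v) (D' v)"
    and z_laurent: "\<And>v. v \<in> U \<Longrightarrow>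
      eventually (\<lambda>p. (\<lambda>n. a (Suc n) v / p ^ Suc n) sums (z p v - p)) at_infinity"
    and z_pde: "\<And>i p v. v \<in> U \<Longrightarrow> p \<in> D v \<Longrightarrow> (\<And>k. p \<noteq> pole k v) \<Longrightarrow>
      partial i (z p) v + R i p v * deriv (\<lambda>x. z x v) p = 0"
    and P: "P = inverse_fun D z"
    \<comment> \<open>the punctures and the functions \<open>\<Omega>\<^sub>A\<close>\<close>
    and z0_distinct: "inj_on z0 {2..M}"
    and z0_in: "\<And>\<alpha> v. \<alpha> \<in> {2..M} \<Longrightarrow> v \<in> U \<Longrightarrow> z0 \<alpha> \<in> D' v"
    and q: "q = (\<lambda>\<alpha> v. P (z0 \<alpha>) v)"
    and pole_neq_q: "\<And>\<alpha> k v. \<alpha> \<in> {2..M} \<Longrightarrow> v \<in> U \<Longrightarrow> pole k v \<noteq> q \<alpha> v"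
    and W: "open W" "W \<subseteq> UNIV \<times> U"
    and lnq_holo: "\<And>\<alpha>. \<alpha> \<in> {2..M} \<Longrightarrow> joint_holomorphic_on (lnq \<alpha>) W"
    and lnq_branch: "\<And>\<alpha> p v. \<alpha> \<in> {2..M} \<Longrightarrow> (p, v) \<in> W \<Longrightarrow> exp (lnq \<alpha> p v) = p - q \<alpha> v"
    and Om: "Om = Omega lnq z0 z q"
    \<comment> \<open>the function \<open>S\<^sub>-\<close>\<close>
    and Sminus_holo: "joint_holomorphic_on Sminus (total_space U D)"
    and Sminus_infinity: "\<And>v. v \<in> U \<Longrightarrow> ((\<lambda>p. Sminus p v) \<longlongrightarrow> 0) at_infinity"
    and F_holo: "\<And>k. vec_holomorphic_on (F k) U"
    and Sminus_pde: "\<And>i p v. v \<in> U \<Longrightarrow> p \<in> D v \<Longrightarrow> (\<And>k. p \<noteq> pole k v) \<Longrightarrow>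
      partial i (Sminus p) v + R i p v * deriv (\<lambda>x. Sminus x v) p =
      (\<Sum>k\<in>UNIV. r i k v * F k v / (p - pole k v))"
    and compat_F: "\<And>i j k v. v \<in> U \<Longrightarrow> i \<noteq> j \<Longrightarrow>
      r i k v * partial j (F k) v - r j k v * partial i (F k) v =
      (\<Sum>l\<in>UNIV - {k}. (r j l v * r i k v - r i l v * r j k v) / (pole k v - pole l v)\<^sup>2
         * (F k v - F l v))"
    and Stot: "Stot = (\<lambda>p v t. time_sum (index_set M) Om p v t + Sminus p v)"
    \<comment> \<open>the dependence of \<open>u\<close> on the times\<close>
    and T_open: "\<And>t A. t \<in> T \<Longrightarrow> A \<in> index_set M \<Longrightarrow>
      eventually (\<lambda>s. t(A := s) \<in> T) (nhds (t A))"
    and T_sums: "\<And>t. t \<in> T \<Longrightarrow> termwise_differentiable (index_set M) Om W t"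
    and u_in: "\<And>t. t \<in> T \<Longrightarrow> u t \<in> U"
    and u_diff: "\<And>t A i. t \<in> T \<Longrightarrow> A \<in> index_set M \<Longrightarrow>
      (\<lambda>s. u (t(A := s)) $ i) field_differentiable at (t A)"
    and pole_in_W: "\<And>t k. t \<in> T \<Longrightarrow> (pole k (u t), u t) \<in> W"
    and hodograph: "\<And>t k. t \<in> T \<Longrightarrow>
      (\<Sum>\<^sub>\<infinity>A\<in>index_set M. t A * deriv (\<lambda>x. Om A x (u t)) (pole k (u t))) + F k (u t) = 0"
  shows "whitham_S_function (index_set M) Om P u
    {(x, t). t \<in> T \<and> x \<in> D' (u t) \<and> (P x (u t), u t) \<in> W}
    (\<lambda>x t. Stot (P x (u t)) (u t) t)"
proof -
  define I where "I = index_set M"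
  interpret whitham_data U r pole D D' z
    using U pole_distinct D D' z_holo z_univalent z_pde by unfold_locales (auto simp: R)
  have laurent: "((\<lambda>x. z x v - x) \<longlongrightarrow> 0) at_infinity" if "v \<in> U" for v
    by (rule laurent_tail_tendsto_0[OF z_laurent[OF that]])
  have transport: "partial i (Om A p) v + R i p v * deriv (\<lambda>x. Om A x v) p =
      (\<Sum>k\<in>UNIV. r i k v / (p - pole k v) * deriv (\<lambda>x. Om A x v) (pole k v))"
    if A: "A \<in> I" and v: "v \<in> U" and p: "p \<in> D v" "(p, v) \<in> W" and poles: "\<And>k. (pole k v, v) \<in> W"
    for A i p v
  proof -
    obtain \<alpha> n where A_eq: "A = (\<alpha>, n)" by (cases A)
    \<comment> \<open>\<open>index_set\<close> omits (1, 0), so n = 0 forces a finite puncture and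
      hence a logarithm.\<close>
    consider "n = 0" "\<alpha> \<in> {2..M}" | "n > 0" "\<alpha> = 1" | "n > 0" "\<alpha> \<in> {2..M}"
      using A by (cases "n = 0"; cases "\<alpha> = 1") (auto simp: A_eq I_def index_set_def)
    thus ?thesis
    proof cases
      case 1
      have "Om A = (\<lambda>p v. - lnq \<alpha> p v)"
        using 1 by (simp add: Om A_eq Omega_def fun_eq_iff)
      moreover have "exp (lnq \<alpha> x w) = x - inverse_fun D z (z0 \<alpha>) w" if "(x, w) \<in> W" for x w
        using lnq_branch[OF 1(2) that] by (simp add: q P)
      moreover have "pole k v \<noteq> inverse_fun D z (z0 \<alpha>) v" for k
        using pole_neq_q[OF 1(2) v, of k] by (simp add: q P)
      ultimately show ?thesis
        using log_transport[OF W(1) lnq_holo[OF 1(2)] _ v z0_in[OF 1(2) v] p poles] by (simp add: R)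
    next
      case 2
      have "Om A = (\<lambda>p v. polynomial_part (\<lambda>x. z x v ^ n) p)"
        using 2 by (simp add: Om A_eq Omega_def fun_eq_iff zfun_def)
      thus ?thesis
        using polynomial_part_transport[OF laurent 2(1) v p(1), of i] by (simp add: R)
    next
      case 3
      have "Om A = (\<lambda>p v. singular_part (\<lambda>x. (1 / (z x v - z0 \<alpha>)) ^ n) (inverse_fun D z (z0 \<alpha>) v) p)"
        using 3 by (simp add: Om A_eq Omega_def fun_eq_iff zfun_def q P)
      \<comment> \<open>An exponential has no zero, so the branch condition keeps \<open>W\<close>
        away from the puncture.\<close>
      moreover have "p \<noteq> inverse_fun D z (z0 \<alpha>) v"
        using lnq_branch[OF 3(2) p(2)] exp_not_eq_zero[of "lnq \<alpha> p v"] by (auto simp: q P)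
      moreover have "pole k v \<noteq> inverse_fun D z (z0 \<alpha>) v" for k
        using pole_neq_q[OF 3(2) v, of k] by (simp add: q P)
      ultimately show ?thesis
        using singular_part_transport[OF z0_in[OF 3(2)] v p(1), of i n] by (simp add: R)
    qed
  qed
  show ?thesis
    unfolding whitham_S_function_def I_def[symmetric]
  proof safe
    fix x t A
    assume t: "t \<in> T" and x: "x \<in> D' (u t)" and inW: "(P x (u t), u t) \<in> W" and A: "A \<in> I"
    define v where "v = u t"
    define p where "p = P x v"
    define \<gamma> where "\<gamma> = (\<lambda>s. u (t(A := s)))"
    define p' where "p' = (\<lambda>s. P x (\<gamma> s))"
    have v: "v \<in> U" using u_in[OF t] by (simp add: v_def)
    have pD: "p \<in> D v" using P_in_D[OF v] x by (simp add: p_def P v_def)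
    have pW: "(p, v) \<in> W" using inW by (simp add: p_def v_def)
    have base: "\<gamma> (t A) = v" "p' (t A) = p" by (simp_all add: \<gamma>_def v_def p'_def p_def)
    have poles: "(pole k v, v) \<in> W" for k using pole_in_W[OF t] by (simp add: v_def)
    have nearT: "eventually (\<lambda>s. t(A := s) \<in> T) (nhds (t A))"
      using T_open[OF t] A by (simp add: I_def)
    have td: "termwise_differentiable I Om W t'" if "t' \<in> T" for t'
      using T_sums[OF that] by (simp add: I_def)

    \<comment> \<open>A second admissible value of t_A is what the difference quotient behind
      \<open>termwise_differentiable_summand\<close> requires.\<close>
    have "eventually (\<lambda>s. t(A := s) \<in> T \<and> s \<noteq> t A) (at (t A))"
      using nearT by (simp add: eventually_at_filter eventually_mono)
    then obtain s where s: "t(A := s) \<in> T" "s \<noteq> t A"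
      using eventually_happens[of _ "at (t A)"] by (auto simp: trivial_limit_at)
    have Om_holo: "joint_holomorphic_on (Om A) W"
      by (rule termwise_differentiable_summand[OF td[OF t] td[OF s(1)] s(2) A W(1)])

    \<comment> \<open>The times in \<open>ts\<close> stay frozen at t while p and u move; the
      explicit change of t_A is accounted for separately as (s - t_A) \<Omega>_A.\<close>
    define ts where "ts = (\<lambda>x w. time_sum I Om x w t)"
    have ts_holo: "joint_holomorphic_on ts W"
      using td[OF t] by (simp add: ts_def termwise_differentiable_def)
    have has_sum_deriv: "((\<lambda>A. t A * deriv (\<lambda>x. Om A x v) y) has_sum deriv (\<lambda>x. ts x v) y) I"
      and has_sum_partial: "((\<lambda>A. t A * partial i (Om A y) v) has_sum partial i (ts y) v) I"
      if "(y, v) \<in> W" for y i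
      using td[OF t] that unfolding termwise_differentiable_def ts_def by auto
    \<comment> \<open>Termwise differentiation turns the hodograph sum into the p-derivative of the
      summed function at the pole.\<close>
    have hodo: "deriv (\<lambda>x. ts x v) (pole k v) = - F k v" for k
      using hodograph[OF t, of k] infsumI[OF has_sum_deriv[OF poles]]
      by (simp add: I_def v_def eq_neg_iff_add_eq_0)

    define c where "c = deriv (\<lambda>x. ts x v) p + deriv (\<lambda>x. Sminus x v) p"
    define d where "d i = partial i (ts p) v + partial i (Sminus p) v" for i
    have char: "d i + R i p v * c = 0" for i
    proof -
      have s1: "((\<lambda>A. t A * partial i (Om A p) v + R i p v * (t A * deriv (\<lambda>x. Om A x v) p)) has_sum
          partial i (ts p) v + R i p v * deriv (\<lambda>x. ts x v) p) I"
        by (intro has_sum_add has_sum_cmult_right has_sum_partial has_sum_deriv pW)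
      have s2: "((\<lambda>A. \<Sum>k\<in>UNIV. r i k v / (p - pole k v) * (t A * deriv (\<lambda>x. Om A x v) (pole k v))) has_sum
          (\<Sum>k\<in>UNIV. r i k v / (p - pole k v) * deriv (\<lambda>x. ts x v) (pole k v))) I"
        by (intro has_sum_finite_sum has_sum_cmult_right has_sum_deriv poles)
      have eq: "t A * partial i (Om A p) v + R i p v * (t A * deriv (\<lambda>x. Om A x v) p) =
          (\<Sum>k\<in>UNIV. r i k v / (p - pole k v) * (t A * deriv (\<lambda>x. Om A x v) (pole k v)))" if "A \<in> I" for A
      proof -
        have "t A * partial i (Om A p) v + R i p v * (t A * deriv (\<lambda>x. Om A x v) p) =
            t A * (partial i (Om A p) v + R i p v * deriv (\<lambda>x. Om A x v) p)"
          by (simp add: algebra_simps)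
        also have "\<dots> = (\<Sum>k\<in>UNIV. r i k v / (p - pole k v) * (t A * deriv (\<lambda>x. Om A x v) (pole k v)))"
          unfolding transport[OF that v pD pW poles] sum_distrib_left
          by (intro sum.cong) (simp_all add: mult_ac)
        finally show ?thesis .
      qed
      have "partial i (ts p) v + R i p v * deriv (\<lambda>x. ts x v) p =
          (\<Sum>k\<in>UNIV. r i k v / (p - pole k v) * deriv (\<lambda>x. ts x v) (pole k v))"
        by (rule has_sum_unique[OF s1 iffD2[OF has_sum_cong[OF eq] s2]])
      also have "\<dots> = - (\<Sum>k\<in>UNIV. r i k v * F k v / (p - pole k v))"
        by (simp add: hodo sum_negf)
      also have "(\<Sum>k\<in>UNIV. r i k v * F k v / (p - pole k v)) =
          partial i (Sminus p) v + R i p v * deriv (\<lambda>x. Sminus x v) p"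
        unfolding R
        by (rule pde_at_poles[OF Sminus_holo v pD, symmetric]) (use Sminus_pde[OF v] R in simp)
      finally show ?thesis by (simp add: c_def d_def algebra_simps)
    qed

    have "\<exists>D. ((\<lambda>s. \<gamma> s $ i) has_field_derivative D) (at (t A))" for i
      using u_diff[OF t, of A i] A by (simp add: \<gamma>_def I_def field_differentiable_def)
    then obtain \<gamma>' where "((\<lambda>s. \<gamma> s $ i) has_field_derivative \<gamma>' i) (at (t A))" for i
      by metis
    hence d\<gamma>: "(\<gamma> has_derivative (\<lambda>k. \<chi> i. \<gamma>' i * k)) (at (t A))"
      by (rule vec_has_derivative)
    have x': "x \<in> D' v" using x by (simp add: v_def)
    \<comment> \<open>With x held fixed, p moves only through u, so only the derivatives
      \<partial>p/\<partial>u_i = R_i enter.\<close>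
    have dp': "(p' has_derivative (\<lambda>k. \<Sum>i\<in>UNIV. R i p v * (\<gamma>' i * k))) (at (t A))"
    proof -
      have "(inverse_fun D z x has_derivative (\<lambda>h. \<Sum>i\<in>UNIV. R i p v * h $ i)) (at (\<gamma> (t A)))"
        using joint_derivative_snd[OF P_has_derivative[OF v x']] by (simp add: base R p_def P)
      from has_derivative_compose[OF d\<gamma> this] show ?thesis
        by (simp add: p'_def P)
    qed
    have path: "((\<lambda>s. (p' s, \<gamma> s)) has_derivative (\<lambda>k. (\<Sum>i\<in>UNIV. R i p v * (\<gamma>' i * k), \<chi> i. \<gamma>' i * k))) (at (t A))"
      by (rule has_derivative_Pair[OF dp' d\<gamma>])
    have cont: "isCont (\<lambda>s. (p' s, \<gamma> s)) (t A)"
      by (rule has_derivative_continuous[OF path])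

    have "((\<lambda>y. (\<lambda>(x, w). ts x w) y + (\<lambda>(x, w). Sminus x w) y) has_derivative
        (\<lambda>y. (\<lambda>(k, h). deriv (\<lambda>x. ts x v) p * k + (\<Sum>i\<in>UNIV. partial i (ts p) v * h $ i)) y +
             (\<lambda>(k, h). deriv (\<lambda>x. Sminus x v) p * k + (\<Sum>i\<in>UNIV. partial i (Sminus p) v * h $ i)) y)) (at (p, v))"
      by (intro has_derivative_add joint_holomorphic_has_derivative[OF ts_holo pW]
          joint_holomorphic_has_derivative[OF Sminus_holo] in_total v pD)
    hence dH: "((\<lambda>y. ts (fst y) (snd y) + Sminus (fst y) (snd y)) has_derivative
        (\<lambda>y. c * fst y + (\<Sum>i\<in>UNIV. d i * snd y $ i))) (at (p' (t A), \<gamma> (t A)))"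
      by (simp add: case_prod_unfold base c_def d_def algebra_simps sum.distrib)
    have "((\<lambda>s. ts (p' s) (\<gamma> s) + Sminus (p' s) (\<gamma> s)) has_derivative
        (\<lambda>k. c * (\<Sum>i\<in>UNIV. R i p v * (\<gamma>' i * k)) + (\<Sum>i\<in>UNIV. d i * (\<gamma>' i * k)))) (at (t A))"
      using has_derivative_compose[OF path dH] by simp
    \<comment> \<open>The velocity \<gamma>' occurs only as a factor of the expressions d_i + R_i c,
      which vanish by \<open>char\<close>.\<close>
    also have "(\<lambda>k. c * (\<Sum>i\<in>UNIV. R i p v * (\<gamma>' i * k)) + (\<Sum>i\<in>UNIV. d i * (\<gamma>' i * k))) = (*) 0"
    proof
      fix k
      have "c * (\<Sum>i\<in>UNIV. R i p v * (\<gamma>' i * k)) + (\<Sum>i\<in>UNIV. d i * (\<gamma>' i * k)) =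
          (\<Sum>i\<in>UNIV. (d i + R i p v * c) * (\<gamma>' i * k))"
        by (simp add: sum_distrib_left sum.distrib[symmetric] algebra_simps)
      thus "c * (\<Sum>i\<in>UNIV. R i p v * (\<gamma>' i * k)) + (\<Sum>i\<in>UNIV. d i * (\<gamma>' i * k)) = 0 * k"
        by (simp add: char)
    qed
    finally have H0: "((\<lambda>s. ts (p' s) (\<gamma> s) + Sminus (p' s) (\<gamma> s)) has_field_derivative 0) (at (t A))"
      by (simp only: has_field_derivative_def)

    have "isCont (\<lambda>(x, w). Om A x w) (p' (t A), \<gamma> (t A))"
      using joint_holomorphic_continuous[OF Om_holo] pW W(1) by (simp add: continuous_on_eq_continuous_at base)
    from isCont_o2[where f = "\<lambda>s. (p' s, \<gamma> s)", OF cont this]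
    have "isCont (\<lambda>s. Om A (p' s) (\<gamma> s)) (t A)" by simp
    from DERIV_add[OF H0 has_field_derivative_mult_continuous[OF this]]
    have main: "((\<lambda>s. ts (p' s) (\<gamma> s) + Sminus (p' s) (\<gamma> s) + (s - t A) * Om A (p' s) (\<gamma> s))
        has_field_derivative Om A p v) (at (t A))"
      by (simp add: base)

    \<comment> \<open>The sum at the moved point is expanded around the original times t, whose
      summability is available on \<open>W\<close>; hence the path has to remain in \<open>W\<close>
      for s near t_A.\<close>
    have "filterlim (\<lambda>s. (p' s, \<gamma> s)) (nhds (p, v)) (nhds (t A))"
      using cont tendsto_at_iff_tendsto_nhds[of "\<lambda>s. (p' s, \<gamma> s)" "t A"] by (simp add: isCont_def base)
    hence nearW: "eventually (\<lambda>s. (p' s, \<gamma> s) \<in> W) (nhds (t A))"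
      by (rule eventually_compose_filterlim[OF eventually_nhds_in_open[OF W(1) pW]])
    have "eventually (\<lambda>s. Stot (P x (u (t(A := s)))) (u (t(A := s))) (t(A := s)) =
        ts (p' s) (\<gamma> s) + Sminus (p' s) (\<gamma> s) + (s - t A) * Om A (p' s) (\<gamma> s)) (nhds (t A))"
      using nearW
    proof eventually_elim
      case (elim s)
      have "(\<lambda>A. t A * Om A (p' s) (\<gamma> s)) summable_on I"
        using td[OF t] elim unfolding termwise_differentiable_def by auto
      from time_sum_upd[of t Om "p' s" "\<gamma> s" I A s, OF this A] show ?case
        by (simp add: Stot ts_def p'_def \<gamma>_def I_def)
    qed
    from DERIV_cong_ev[OF refl this refl] main
    show "((\<lambda>s. Stot (P x (u (t(A := s)))) (u (t(A := s))) (t(A := s))) has_field_derivative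
        Om A (P x (u t)) (u t)) (at (t A))"
      by (simp add: p_def v_def)
  qed
qed

end
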